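(* Consider the system $\dot R=R\hat\Omega$, $\mathbb I\dot\Omega=(\mathbb I\Omega)\times\Omega+\tau$. Choose any positive constants $k_R,k_\Omega,a,\mu,\sigma,\epsilon,\theta_{b_0},\gamma$ such that $0<a<1$, $0<\epsilon<1$, $$0<\mu<\frac{4(1-a)k_Rk_\Omega}{4(1-a)k_R+k_\Omega^2},\qquad \sigma=\frac{\lambda_{\min}(W_3)}{\lambda_{\max}(W_2)},$$ $$\theta_{b_0}\in(0,\theta_0),\qquad 1-\cos(\theta_0-\theta_{b_0})\le2\epsilon a,\qquad \gamma<\frac4{\theta_{b_0}}\sqrt{ak_R(1-\epsilon)},$$ where the conditions involving $\theta_0$ (the angle determined by the initial attitude) concern the initial states for which the second case of the control below is used. Let the control input be $$\tau=\begin{cases}-(\mathbb I\Omega)\times\Omega+\mathbb I(-k_Re_R-k_\Omega e_\Omega+\Omega\times\Omega_d+\dot\Omega_d)&\text{when }V_0(R(0),\Omega(0),0)\le2ak_R,\\-(\mathbb I\Omega)\times\Omega+\mathbb I(-k_R\tilde e_R-k_\Omega\tilde e_\Omega+\Omega\times\tilde\Omega_d+\dot{\tilde\Omega}_d)&\text{when }V_0(R(0),\Omega(0),0)>2ak_R.\end{cases}$$ Then the zero equilibrium of the tracking errors $(E_R,e_\Omega)=(0,0)$ is exponentially stable. More specifically: (a) There exists a constant $c>0$ such that, for every initial state with $V_0(R(0),\Omega(0),0)\le2ak_R$, $$\|E_R(t)\|+\|e_\Omega(t)\|\le c(\|E_R(0)\|+\|e_\Omega(0)\|)e^{-\frac\sigma2t}\quad\text{for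 all }t\ge0.$$ (b) Otherwise, when $V_0(R(0),\Omega(0),0)>2ak_R$, there exists a constant $c>0$ such that, for any initial state $(R(0),\Omega(0))\in \mathrm{SO}(3)\times\mathbb R^3$ satisfying $$\frac{k_R}4\|R(0)-\tilde R_d(0)\|^2+\frac12\|\Omega(0)-\tilde\Omega_d(0)\|^2\le2ak_R,$$ one has $$\|E_R(t)\|+\|e_\Omega(t)\|\le c(\|E_R(0)\|+\|e_\Omega(0)\|)e^{-\frac12\min\{\sigma,\gamma\}t}\quad\text{for all }t\ge0.$$
   Context: $\|A\|^2=\operatorname{tr}(A^TA)$ for a matrix or vector $A$; $\lambda_{\min},\lambda_{\max}$ are the minimum and maximum eigenvalues of a symmetric matrix. The hat map is defined by $\hat v w=v\times w$ for $v,w\in\mathbb R^3$; $\vee$ is its inverse on skew-symmetric matrices. $e_3=(0,0,1)$, $Z_\theta=\exp(\theta\hat e_3)$. $\mathbb I\in\mathbb R^{3\times3}$ is a symmetric positive-definite (inertia) matrix, $R\in \mathrm{SO}(3)$ the attitude, $\Omega\in\mathbb R^3$ the angular velocity. $(R_d(t),\Omega_d(t))\in \mathrm{SO}(3)\times\mathbb R^3$, $t\ge0$, is a given smooth reference trajectory with $\dot R_d=R_d\hat\Omega_d$. Errors: $E_R=R-R_d$, $e_\Omega=\Omega-\Omega_d$, $e_R=\frac12(R_d^TR-R^TR_d)^\vee$, and $V_0(R,\Omega,t)=\frac{k_R}4\|E_R\|^2+\frac12\|e_\Omega\|^2$. Matrices: $$W_2=\begin{bmatrix}\frac14k_R&\frac1{2\sqrt2}\mu\\\frac1{2\sqrt2}\mu&\frac12\end{bmatrix},\qquad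 W_3=\begin{bmatrix}\frac{1-a}2\mu k_R&-\frac1{2\sqrt2}\mu k_\Omega\\-\frac1{2\sqrt2}\mu k_\Omega&k_\Omega-\mu\end{bmatrix}.$$ Shifted reference: given $R(0)$, let $\theta_0\in[0,\pi]$ be the unique angle for which there is $U_0\in \mathrm{SO}(3)$ with $R(0)=U_0Z_{\theta_0}U_0^TR_d(0)$, and fix such a $U_0$. With $\theta_{b_0}\in(0,\theta_0)$ set $$\theta_b(t)=\theta_{b_0}e^{-\frac\gamma2t},\quad\tilde R_d(t)=U_0Z_{\theta_b(t)}U_0^TR_d(t),\quad\tilde\Omega_d(t)=\Omega_d(t)+\dot\theta_b(t)\tilde R_d(t)^TU_0e_3,$$ so that $\dot{\tilde R}_d=\tilde R_d\hat{\tilde\Omega}_d$. The shifted errors are $\tilde e_R=\frac12(\tilde R_d^TR-R^T\tilde R_d)^\vee$ and $\tilde e_\Omega=\Omega-\tilde\Omega_d$. *)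

theory Defs
  imports "HOL-Analysis.Analysis"
begin

unbundle cross3_syntax

text \<open>
  The norm of the type \<^typ>\<open>real^'n^'m\<close> is the Frobenius norm. The rotation group SO(3) is
  given by the library predicate \<^const>\<open>rotation_matrix\<close>, and the unit vector
  (0,0,1) is \<^term>\<open>axis 3 1 :: real^3\<close>.
\<close>

lemma norm_matrix_eq_trace:
  fixes A :: "real^'n^'m"
  shows "(norm A)\<^sup>2 = trace (transpose A ** A)"
proof -
  have "(norm A)\<^sup>2 = (\<Sum>i\<in>UNIV. \<Sum>j\<in>UNIV. A $ i $ j * A $ i $ j)"
    unfolding power2_norm_eq_inner by (simp add: inner_vec_def)
  also have "\<dots> = (\<Sum>j\<in>UNIV. \<Sum>i\<in>UNIV. A $ i $ j * A $ i $ j)"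
    by (rule sum.swap)
  also have "\<dots> = trace (transpose A ** A)"
    by (simp add: trace_def transpose_def matrix_matrix_mult_def)
  finally show ?thesis .
qed

definition hat :: "real^3 \<Rightarrow> real^3^3"
  where "hat v = matrix (\<lambda>w. v \<times> w)"

lemma hat_mult_vec: "hat v *v w = v \<times> w"
  unfolding hat_def
  by (simp add: matrix_works linear_iff cross_add_right cross_mult_right)

lemma inj_hat: "inj hat"
proof (rule injI)
  fix v w assume "hat v = hat w"
  then have "v \<times> x = w \<times> x" for x
    by (simp flip: hat_mult_vec)
  from this[of "axis 1 1"] this[of "axis 2 1"] show "v = w"
    by (simp add: vec_eq_iff forall_3 cross_components axis_def)
qed

definition vee :: "real^3^3 \<Rightarrow> real^3"
  where "vee = inv hat"

lemma vee_hat: "vee (hat v) = v"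
  by (simp add: vee_def inj_hat)

definition matrix_exp :: "real^'n^'n \<Rightarrow> real^'n^'n"
  where "matrix_exp A = (\<Sum>k. (1 / fact k) *\<^sub>R (((**) A) ^^ k) (mat 1))"

definition Z_rot :: "real \<Rightarrow> real^3^3"
  where "Z_rot \<theta> = matrix_exp (\<theta> *\<^sub>R hat (axis 3 1))"

definition spd_matrix :: "real^'n^'n \<Rightarrow> bool"
  where "spd_matrix A \<longleftrightarrow> transpose A = A \<and> (\<forall>v. v \<noteq> 0 \<longrightarrow> 0 < v \<bullet> (A *v v))"

definition eigenvalues :: "real^'n^'n \<Rightarrow> real set"
  where "eigenvalues A = {l. \<exists>v. v \<noteq> 0 \<and> A *v v = l *\<^sub>R v}"

definition lambda_min :: "real^'n^'n \<Rightarrow> real"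
  where "lambda_min A = Min (eigenvalues A)"

definition lambda_max :: "real^'n^'n \<Rightarrow> real"
  where "lambda_max A = Max (eigenvalues A)"

definition W2 :: "real \<Rightarrow> real \<Rightarrow> real^2^2"
  where "W2 kR \<mu> =
    vector [vector [kR / 4, \<mu> / (2 * sqrt 2)],
            vector [\<mu> / (2 * sqrt 2), 1 / 2]]"

definition W3 :: "real \<Rightarrow> real \<Rightarrow> real \<Rightarrow> real \<Rightarrow> real^2^2"
  where "W3 kR k\<Omega> a \<mu> =
    vector [vector [(1 - a) / 2 * \<mu> * kR, - (\<mu> * k\<Omega> / (2 * sqrt 2))],
            vector [- (\<mu> * k\<Omega> / (2 * sqrt 2)), k\<Omega> - \<mu>]]"

text \<open>
  All signals live on the time interval from 0 to infinity; derivatives at time 0 are one-sided.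
\<close>

definition dt :: "(real \<Rightarrow> 'a::real_normed_vector) \<Rightarrow> real \<Rightarrow> 'a"
  where "dt f t = vector_derivative f (at t within {0..})"

text \<open>In the next definition, \<open>D n\<close> is the \<open>n\<close>-th derivative of \<open>f\<close>.\<close>

definition smooth_signal :: "(real \<Rightarrow> 'a::real_normed_vector) \<Rightarrow> bool"
  where "smooth_signal f \<longleftrightarrow>
    (\<exists>D. (\<forall>t\<ge>0. D 0 t = f t) \<and>
         (\<forall>n. \<forall>t\<ge>0. (D n has_vector_derivative D (Suc n) t) (at t within {0..})))"

definition reference_trajectory :: "(real \<Rightarrow> real^3^3) \<Rightarrow> (real \<Rightarrow> real^3) \<Rightarrow> bool"
  where "reference_trajectory Rd \<Omega>d \<longleftrightarrow>
    smooth_signal Rd \<and> smooth_signal \<Omega>d \<and>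
    (\<forall>t\<ge>0. rotation_matrix (Rd t) \<and>
      (Rd has_vector_derivative Rd t ** hat (\<Omega>d t)) (at t within {0..}))"

definition e_R :: "real^3^3 \<Rightarrow> real^3^3 \<Rightarrow> real^3"
  where "e_R Rd R = (1 / 2) *\<^sub>R vee (transpose Rd ** R - transpose R ** Rd)"

definition V0 ::
  "real \<Rightarrow> (real \<Rightarrow> real^3^3) \<Rightarrow> (real \<Rightarrow> real^3) \<Rightarrow> real^3^3 \<Rightarrow> real^3 \<Rightarrow> real \<Rightarrow> real"
  where "V0 kR Rd \<Omega>d R \<Omega> t = kR / 4 * (norm (R - Rd t))\<^sup>2 + 1 / 2 * (norm (\<Omega> - \<Omega>d t))\<^sup>2"

definition theta_b :: "real \<Rightarrow> real \<Rightarrow> real \<Rightarrow> real"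
  where "theta_b \<theta>b0 \<gamma> t = \<theta>b0 * exp (- (\<gamma> / 2) * t)"

definition shifted_Rd ::
  "real \<Rightarrow> real \<Rightarrow> real^3^3 \<Rightarrow> (real \<Rightarrow> real^3^3) \<Rightarrow> real \<Rightarrow> real^3^3"
  where "shifted_Rd \<theta>b0 \<gamma> U Rd t = U ** Z_rot (theta_b \<theta>b0 \<gamma> t) ** transpose U ** Rd t"

definition shifted_\<Omega>d ::
  "real \<Rightarrow> real \<Rightarrow> real^3^3 \<Rightarrow> (real \<Rightarrow> real^3^3) \<Rightarrow> (real \<Rightarrow> real^3) \<Rightarrow> real \<Rightarrow> real^3"
  where "shifted_\<Omega>d \<theta>b0 \<gamma> U Rd \<Omega>d t =
    \<Omega>d t + dt (theta_b \<theta>b0 \<gamma>) t *\<^sub>R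
      (transpose (shifted_Rd \<theta>b0 \<gamma> U Rd t) *v (U *v axis 3 1))"

text \<open>
  The feedback law that tracks a reference \<open>(Rd, \<Omega>d)\<close>, evaluated at the state \<open>(R, \<Omega>)\<close> and the
  time \<open>t\<close>; \<open>J\<close> is the inertia matrix. It is used both for the given and for the shifted reference.
\<close>

definition tracking_torque ::
  "real^3^3 \<Rightarrow> real \<Rightarrow> real \<Rightarrow> (real \<Rightarrow> real^3^3) \<Rightarrow> (real \<Rightarrow> real^3)
    \<Rightarrow> real^3^3 \<Rightarrow> real^3 \<Rightarrow> real \<Rightarrow> real^3"
  where "tracking_torque J kR k\<Omega> Rd \<Omega>d R \<Omega> t =
    - ((J *v \<Omega>) \<times> \<Omega>) +
    J *v (- (kR *\<^sub>R e_R (Rd t) R) - k\<Omega> *\<^sub>R (\<Omega> - \<Omega>d t) + \<Omega> \<times> \<Omega>d t + dt \<Omega>d t)"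

text \<open>
  The functions \<open>\<theta>0\<close> and \<open>U0\<close> choose, for every initial attitude \<open>R0\<close>, the angle and a rotation
  matrix that bring the initial attitude error to a rotation about the third axis. The angle is
  uniquely determined by \<open>R0\<close>, the matrix is not.
\<close>

definition attitude_error_choice ::
  "real^3^3 \<Rightarrow> (real^3^3 \<Rightarrow> real) \<Rightarrow> (real^3^3 \<Rightarrow> real^3^3) \<Rightarrow> bool"
  where "attitude_error_choice Rd0 \<theta>0 U0 \<longleftrightarrow>
    (\<forall>R0. rotation_matrix R0 \<longrightarrow>
      0 \<le> \<theta>0 R0 \<and> \<theta>0 R0 \<le> pi \<and> rotation_matrix (U0 R0) \<and>
      R0 = U0 R0 ** Z_rot (\<theta>0 R0) ** transpose (U0 R0) ** Rd0)"

text \<open>The control input along a motion \<open>(R, \<Omega>)\<close>; the case is selected by the initial state.\<close>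

definition control_input ::
  "real^3^3 \<Rightarrow> real \<Rightarrow> real \<Rightarrow> real \<Rightarrow> real \<Rightarrow> real \<Rightarrow> (real^3^3 \<Rightarrow> real^3^3)
    \<Rightarrow> (real \<Rightarrow> real^3^3) \<Rightarrow> (real \<Rightarrow> real^3)
    \<Rightarrow> (real \<Rightarrow> real^3^3) \<Rightarrow> (real \<Rightarrow> real^3) \<Rightarrow> real \<Rightarrow> real^3"
  where "control_input J kR k\<Omega> a \<theta>b0 \<gamma> U0 Rd \<Omega>d R \<Omega> t =
    (if V0 kR Rd \<Omega>d (R 0) (\<Omega> 0) 0 \<le> 2 * a * kR
     then tracking_torque J kR k\<Omega> Rd \<Omega>d (R t) (\<Omega> t) t
     else tracking_torque J kR k\<Omega>
            (shifted_Rd \<theta>b0 \<gamma> (U0 (R 0)) Rd)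
            (shifted_\<Omega>d \<theta>b0 \<gamma> (U0 (R 0)) Rd \<Omega>d)
            (R t) (\<Omega> t) t)"

definition rigid_body_motion ::
  "real^3^3 \<Rightarrow> (real \<Rightarrow> real^3) \<Rightarrow> (real \<Rightarrow> real^3^3) \<Rightarrow> (real \<Rightarrow> real^3) \<Rightarrow> bool"
  where "rigid_body_motion J \<tau> R \<Omega> \<longleftrightarrow>
    (\<forall>t\<ge>0. rotation_matrix (R t) \<and>
      (R has_vector_derivative R t ** hat (\<Omega> t)) (at t within {0..}) \<and>
      \<Omega> differentiable (at t within {0..}) \<and>
      J *v dt \<Omega> t = (J *v \<Omega> t) \<times> \<Omega> t + \<tau> t)"

definition closed_loop_motion ::
  "real^3^3 \<Rightarrow> real \<Rightarrow> real \<Rightarrow> real \<Rightarrow> real \<Rightarrow> real \<Rightarrow> (real^3^3 \<Rightarrow> real^3^3)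
    \<Rightarrow> (real \<Rightarrow> real^3^3) \<Rightarrow> (real \<Rightarrow> real^3)
    \<Rightarrow> (real \<Rightarrow> real^3^3) \<Rightarrow> (real \<Rightarrow> real^3) \<Rightarrow> bool"
  where "closed_loop_motion J kR k\<Omega> a \<theta>b0 \<gamma> U0 Rd \<Omega>d R \<Omega> \<longleftrightarrow>
    rigid_body_motion J (control_input J kR k\<Omega> a \<theta>b0 \<gamma> U0 Rd \<Omega>d R \<Omega>) R \<Omega>"

text \<open>
  Exponential stability of the zero equilibrium of the system whose trajectories, started at
  time 0, form the set \<open>\<E>\<close>. The first conjunct says that zero is an equilibrium.
\<close>

definition zero_exponentially_stable :: "(real \<Rightarrow> 'a::real_normed_vector) set \<Rightarrow> bool"
  where "zero_exponentially_stable \<E> \<longleftrightarrow>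
    (\<exists>e\<in>\<E>. \<forall>t\<ge>0. e t = 0) \<and>
    (\<exists>r>0. \<exists>c>0. \<exists>\<beta>>0. \<forall>e\<in>\<E>. norm (e 0) < r \<longrightarrow>
      (\<forall>t\<ge>0. norm (e t) \<le> c * norm (e 0) * exp (- \<beta> * t)))"

end

theory Submission
  imports Defs
begin

text \<open>
  Along the closed loop the energy \<open>V0\<close> satisfies \<open>V0' = - k\<Omega> |e\<^sub>\<Omega>|\<^sup>2\<close>, so its sublevel set \<open>V0 \<le> 2 a kR\<close> is
  invariant. On it \<open>|E\<^sub>R|\<^sup>2 \<le> 8 a\<close>, and since \<open>|e\<^sub>R|\<^sup>2 = |E\<^sub>R|\<^sup>2 (1 - |E\<^sub>R|\<^sup>2 / 8) / 2\<close> for rotations, the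
  attitude error vector controls \<open>E\<^sub>R\<close>. Hence \<open>V1 = V0 + \<mu> e\<^sub>R \<bullet> e\<^sub>\<Omega>\<close> satisfies \<open>V1' \<le> - \<sigma> V1\<close>, and
  \<open>\<mu> < sqrt kR\<close> makes \<open>V1\<close> comparable to \<open>V0\<close>. The shifted reference obeys the same kinematics and
  approaches the given one like \<open>exp (- \<gamma> t / 2)\<close>, so the second case follows from the triangle
  inequality; the additive constants are absorbed into the initial error, which is bounded below
  when \<open>V0 > 2 a kR\<close>.
\<close>

subsection \<open>Rotations and the attitude error\<close>

text \<open>In coordinates this is the vector whose hat matrix is \<open>M - transpose M\<close>. It
  lets \<open>e_R\<close> be computed without evaluating the inverse function behind
  \<open>vee\<close>.\<close>

definition axial :: "real^3^3 \<Rightarrow> real^3"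
  where "axial M = vector [M$3$2 - M$2$3, M$1$3 - M$3$1, M$2$1 - M$1$2]"

lemma axial_components [simp]:
  "axial M $ 1 = M$3$2 - M$2$3" "axial M $ 2 = M$1$3 - M$3$1" "axial M $ 3 = M$2$1 - M$1$2"
  by (simp_all add: axial_def)

lemma hat_components [simp]:
  "hat v $ 1 $ 1 = 0" "hat v $ 1 $ 2 = - v$3" "hat v $ 1 $ 3 = v$2"
  "hat v $ 2 $ 1 = v$3" "hat v $ 2 $ 2 = 0" "hat v $ 2 $ 3 = - v$1"
  "hat v $ 3 $ 1 = - v$2" "hat v $ 3 $ 2 = v$1" "hat v $ 3 $ 3 = 0"
  by (simp_all add: hat_def matrix_def cross_components axis_def)

lemma mat3_mult_component:
  "((A::real^3^3) ** B) $ i $ j = A$i$1 * B$1$j + A$i$2 * B$2$j + A$i$3 * B$3$j"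
  by (simp add: matrix_matrix_mult_def sum_3)

lemma mat3_vec_component:
  "((A::real^3^3) *v x) $ i = A$i$1 * x$1 + A$i$2 * x$2 + A$i$3 * x$3"
  by (simp add: matrix_vector_mult_def sum_3)

lemma transpose_component: "transpose A $ i $ j = A $ j $ i"
  by (simp add: transpose_def)

lemma trace_3: "trace (A::real^3^3) = A$1$1 + A$2$2 + A$3$3"
  by (simp add: trace_def sum_3)

lemma inner_3: "(x::real^3) \<bullet> y = x$1 * y$1 + x$2 * y$2 + x$3 * y$3"
  by (simp add: inner_vec_def sum_3)

lemmas mat3_simps = mat3_mult_component mat3_vec_component transpose_component trace_3 inner_3
  cross_components

lemma hat_axial: "hat (axial M) = M - transpose M"
  by (simp add: vec_eq_iff forall_3 transpose_component)

lemma e_R_eq_axial: "e_R Rd R = (1/2) *\<^sub>R axial (transpose Rd ** R)"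
proof -
  have "transpose Rd ** R - transpose R ** Rd = hat (axial (transpose Rd ** R))"
    by (simp add: hat_axial matrix_transpose_mul)
  then show ?thesis
    by (simp add: e_R_def vee_hat)
qed

lemma linear_axial: "linear axial"
  by (simp add: linear_iff vec_eq_iff forall_3 algebra_simps)

lemma linear_trace: "linear (trace :: real^'n^'n \<Rightarrow> real)"
  by (simp add: linear_iff trace_def sum.distrib sum_distrib_left)

lemma linear_transpose: "linear (transpose :: real^'n^'m \<Rightarrow> real^'m^'n)"
  by (simp add: linear_iff vec_eq_iff transpose_def)

lemma bounded_bilinear_matrix_mult:
  "bounded_bilinear ((**) :: real^'n^'m \<Rightarrow> real^'p^'n \<Rightarrow> real^'p^'m)"
  unfolding bilinear_conv_bounded_bilinear[symmetric] bilinear_def linear_iff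
  by (simp add: vec_eq_iff matrix_matrix_mult_def sum.distrib sum_distrib_left algebra_simps)

lemma bounded_bilinear_matrix_vector_mult:
  "bounded_bilinear ((*v) :: real^'n^'m \<Rightarrow> real^'n \<Rightarrow> real^'m)"
  unfolding bilinear_conv_bounded_bilinear[symmetric] bilinear_def linear_iff
  by (simp add: vec_eq_iff matrix_vector_mult_def sum.distrib sum_distrib_left algebra_simps)

lemma rotation_matrixD:
  assumes "rotation_matrix (A::real^'n^'n)"
  shows "transpose A ** A = mat 1" "A ** transpose A = mat 1" "det A = 1"
  using assms by (simp_all add: rotation_matrix_def orthogonal_matrix_def)

lemma rotation_matrix_mul:
  "rotation_matrix A \<Longrightarrow> rotation_matrix B \<Longrightarrow> rotation_matrix (A ** (B::real^'n^'n))"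
  by (simp add: rotation_matrix_def orthogonal_matrix_mul det_mul)

lemma rotation_matrix_transpose:
  "rotation_matrix A \<Longrightarrow> rotation_matrix (transpose (A::real^'n^'n))"
  by (simp add: rotation_matrix_def orthogonal_matrix_transpose det_transpose)

lemma norm_rotation_mult_vec:
  "rotation_matrix (A::real^'n^'n) \<Longrightarrow> norm (A *v x) = norm x"
  using orthogonal_transformation_matrix[of "(*v) A"]
  by (simp add: rotation_matrix_def orthogonal_transformation)

text \<open>When the trace is expanded, the two squares contribute 3 each and the mixed terms are
  transposes of one another. The attitude energy thus becomes affine in \<open>trace Q\<close> for
  \<open>Q = transpose Rd ** R\<close>.\<close>

lemma norm_rotation_diff_sq:
  fixes R Rd :: "real^3^3"
  assumes "rotation_matrix R" "rotation_matrix Rd"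
  shows "(norm (R - Rd))\<^sup>2 = 6 - 2 * trace (transpose Rd ** R)"
proof -
  have "transpose (R - Rd) ** (R - Rd)
      = transpose R ** R - transpose R ** Rd - transpose Rd ** R + transpose Rd ** Rd"
    by (simp add: vec_eq_iff transpose_def matrix_matrix_mult_def sum.distrib sum_subtractf algebra_simps)
  also have "trace \<dots> = trace (transpose R ** R) - trace (transpose R ** Rd)
      - trace (transpose Rd ** R) + trace (transpose Rd ** Rd)"
    by (simp add: trace_3)
  also have "trace (transpose R ** Rd) = trace (transpose Rd ** R)"
    by (simp add: mat3_simps)
  finally show ?thesis
    by (simp add: norm_matrix_eq_trace rotation_matrixD[OF assms(1)] rotation_matrixD[OF assms(2)]
        trace_3 mat_def)
qed

text \<open>A rotation is its own cofactor matrix, so its principal \<open>2 \<times> 2\<close> minors are its diagonal entries.\<close>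

lemma norm_axial_rotation_sq:
  assumes "rotation_matrix Q"
  shows "(norm (axial Q))\<^sup>2 = (3 - trace Q) * (1 + trace Q)"
proof -
  have cr: "(Q *v axis i 1) \<times> (Q *v axis j 1) = Q *v (axis i 1 \<times> axis j 1)" for i j
    using cross_rotation_matrix[OF assms] .
  have minors: "Q$2$2 * Q$3$3 - Q$3$2 * Q$2$3 = Q$1$1" "Q$3$3 * Q$1$1 - Q$1$3 * Q$3$1 = Q$2$2"
    "Q$1$1 * Q$2$2 - Q$2$1 * Q$1$2 = Q$3$3"
    using arg_cong[OF cr[of 2 3], of "\<lambda>v. v$1"] arg_cong[OF cr[of 3 1], of "\<lambda>v. v$2"]
      arg_cong[OF cr[of 1 2], of "\<lambda>v. v$3"]
    by (simp_all add: mat3_simps axis_def algebra_simps)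
  have fro: "trace (transpose Q ** Q) = 3"
    by (simp add: rotation_matrixD[OF assms] trace_3 mat_def)
  have "(norm (axial Q))\<^sup>2 = trace (transpose Q ** Q) - (trace Q)\<^sup>2
      + 2 * ((Q$2$2 * Q$3$3 - Q$3$2 * Q$2$3) + (Q$3$3 * Q$1$1 - Q$1$3 * Q$3$1)
      + (Q$1$1 * Q$2$2 - Q$2$1 * Q$1$2))"
    unfolding power2_norm_eq_inner by (simp add: mat3_simps power2_eq_square algebra_simps)
  then show ?thesis
    unfolding minors fro by (simp add: trace_3 power2_eq_square algebra_simps)
qed

text \<open>For \<open>Q = transpose Rd ** R\<close> and x the norm of \<open>R - Rd\<close>, the
  factors \<open>3 - trace Q\<close> and \<open>1 + trace Q\<close> are x^2/2 and 4 - x^2/2. The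
  second one vanishes at x^2 = 8, a half turn; there the error vector no longer detects the attitude
  error.\<close>

lemma norm_e_R_sq:
  assumes "rotation_matrix R" "rotation_matrix Rd"
  shows "(norm (e_R Rd R))\<^sup>2 = (norm (R - Rd))\<^sup>2 / 2 * (1 - (norm (R - Rd))\<^sup>2 / 8)"
proof -
  have "rotation_matrix (transpose Rd ** R)"
    using assms by (intro rotation_matrix_mul rotation_matrix_transpose)
  from norm_axial_rotation_sq[OF this] show ?thesis
    by (simp add: e_R_eq_axial norm_rotation_diff_sq[OF assms] power_divide field_simps)
qed

text \<open>The left-hand side is \<open>\<Sum>\<^sub>i (w \<times> e\<^sub>i) \<bullet> Q (w \<times> e\<^sub>i)\<close>, and \<open>Q\<close> is an isometry.\<close>

lemma rotation_quadratic_form_le: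
  fixes Q :: "real^3^3"
  assumes "rotation_matrix Q"
  shows "trace Q * (w \<bullet> w) - w \<bullet> (Q *v w) \<le> 2 * (w \<bullet> w)"
proof -
  define c :: "3 \<Rightarrow> real^3" where "c i = w \<times> axis i 1" for i
  have "trace Q * (w \<bullet> w) - w \<bullet> (Q *v w) = (\<Sum>i\<in>UNIV. c i \<bullet> (Q *v c i))"
    by (simp add: c_def sum_3 mat3_simps axis_def algebra_simps)
  also have "\<dots> \<le> (\<Sum>i\<in>UNIV. c i \<bullet> c i)"
  proof (rule sum_mono)
    fix i
    have "c i \<bullet> (Q *v c i) \<le> norm (c i) * norm (Q *v c i)"
      by (rule norm_cauchy_schwarz)
    also have "\<dots> = c i \<bullet> c i"
      by (simp add: norm_rotation_mult_vec[OF assms] dot_square_norm power2_eq_square)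
    finally show "c i \<bullet> (Q *v c i) \<le> c i \<bullet> c i" .
  qed
  also have "\<dots> = 2 * (w \<bullet> w)"
    by (simp add: c_def sum_3 mat3_simps axis_def algebra_simps)
  finally show ?thesis .
qed

section \<open>Rates of the energy and of the cross term\<close>

lemma trace_error_dynamics:
  "trace (Q ** hat u - hat d ** Q) = - (axial Q \<bullet> (u - d))"
  by (simp add: mat3_simps algebra_simps)

text \<open>The gyroscopic term does no work: \<open>u \<times> d\<close> equals
  \<open>(u - d) \<times> d\<close>, which is orthogonal to \<open>u - d\<close>.\<close>

lemma velocity_error_power:
  "(u - d) \<bullet> (- (kR *\<^sub>R e) - kW *\<^sub>R (u - d) + u \<times> d)
    = - kR * (e \<bullet> (u - d)) - kW * ((u - d) \<bullet> (u - d))"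
  by (simp add: mat3_simps algebra_simps)

text \<open>Write \<open>w = u - d\<close> and \<open>q = axial Q\<close>, and split the rate of Q
  into \<open>Q ** hat w\<close> and the commutator of Q with \<open>hat d\<close>. The commutator
  has axial vector \<open>q \<times> d\<close>, which cancels the gyroscopic term after pairing with
  w; the remaining part gives the quadratic form bounded in
  \<open>rotation_quadratic_form_le\<close>.\<close>

lemma cross_term_dynamics:
  "(1/2) *\<^sub>R axial (Q ** hat u - hat d ** Q) \<bullet> (u - d)
    + (1/2) *\<^sub>R axial Q \<bullet> (- (kR *\<^sub>R ((1/2) *\<^sub>R axial Q)) - kW *\<^sub>R (u - d) + u \<times> d)
  = (trace Q * ((u - d) \<bullet> (u - d)) - (u - d) \<bullet> (Q *v (u - d))) / 2
    - kR * (((1/2) *\<^sub>R axial Q) \<bullet> ((1/2) *\<^sub>R axial Q)) - kW * ((1/2) *\<^sub>R axial Q \<bullet> (u - d))"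
  by (simp add: mat3_simps field_simps)

subsection \<open>Eigenvalues of symmetric \<open>2 \<times> 2\<close> matrices\<close>

text \<open>Eigenvalues are the roots of a quadratic whose discriminant \<open>s\<^sup>2\<close> is
  a sum of squares, hence real. Having the set explicitly allows its \<open>Min\<close> and
  \<open>Max\<close> to be evaluated.\<close>

lemma eigenvalues_sym_2:
  fixes p q r :: real
  defines "A \<equiv> vector [vector [p, q], vector [q, r]] :: real^2^2"
    and "s \<equiv> sqrt ((p - r)\<^sup>2 + 4 * q\<^sup>2)"
  shows "eigenvalues A = {(p + r - s) / 2, (p + r + s) / 2}"
proof -
  have "l \<in> eigenvalues A \<longleftrightarrow> (p - l) * (r - l) = q * q" for l
  proof -
    have "l \<in> eigenvalues A \<longleftrightarrow> (\<exists>v. v \<noteq> 0 \<and> (A - mat l) *v v = 0)"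
      by (simp add: eigenvalues_def matrix_vector_mult_diff_rdistrib)
        (simp add: vec_eq_iff matrix_vector_mult_def mat_def forall_2 sum_2)
    also have "\<dots> \<longleftrightarrow> \<not> invertible (A - mat l)"
      by (metis invertible_left_inverse matrix_left_invertible_ker)
    also have "\<dots> \<longleftrightarrow> det (A - mat l) = 0"
      by (simp add: invertible_det_nz)
    also have "\<dots> \<longleftrightarrow> (p - l) * (r - l) = q * q"
      by (simp add: det_2 A_def mat_def)
    finally show ?thesis .
  qed
  moreover have "(p - l) * (r - l) = q * q \<longleftrightarrow> l \<in> {(p + r - s) / 2, (p + r + s) / 2}" for l
  proof -
    have ss: "s * s = (p - r)\<^sup>2 + 4 * q\<^sup>2"
      by (simp add: s_def)
    have "(2 * l - (p + r - s)) * (2 * l - (p + r + s)) = (2 * l - p - r)\<^sup>2 - s * s"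
      by (simp add: power2_eq_square algebra_simps)
    also have "\<dots> = 4 * ((p - l) * (r - l) - q * q)"
      unfolding ss by (simp add: power2_eq_square algebra_simps)
    finally have "(p - l) * (r - l) = q * q
        \<longleftrightarrow> (2 * l - (p + r - s)) * (2 * l - (p + r + s)) = 0"
      by simp
    moreover have "l \<in> {(p + r - s) / 2, (p + r + s) / 2}
        \<longleftrightarrow> 2 * l - (p + r - s) = 0 \<or> 2 * l - (p + r + s) = 0"
      by auto
    ultimately show ?thesis
      by (simp only: mult_eq_0_iff)
  qed
  ultimately show ?thesis
    by blast
qed

text \<open>The determinant is zero, so \<alpha> times the form is a perfect square; if \<alpha> =
  0, then q = 0 and one square is left.\<close>

lemma psd_form_2:
  fixes \<alpha> \<beta> q x y :: real
  assumes "0 \<le> \<alpha>" "0 \<le> \<beta>" "\<alpha> * \<beta> = q * q"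
  shows "0 \<le> \<alpha> * x\<^sup>2 + 2 * q * x * y + \<beta> * y\<^sup>2"
proof (cases "\<alpha> = 0")
  case True
  then show ?thesis using assms by simp
next
  case False
  have "\<alpha> * (\<alpha> * x\<^sup>2 + 2 * q * x * y + \<beta> * y\<^sup>2) = (\<alpha> * x + q * y)\<^sup>2"
    using assms(3) by (simp add: power2_eq_square algebra_simps)
  then show ?thesis
    using False assms(1) by (metis zero_le_mult_iff zero_le_power2 order_le_less not_le)
qed

text \<open>Subtracting the smallest eigenvalue from the diagonal of A, or subtracting A from the
  largest one, leaves a singular matrix. Its diagonal is nonnegative since |p - r| \<le> s, so
  \<open>psd_form_2\<close> applies to both.\<close>

lemma quadratic_form_bounds_sym_2:
  fixes p q r x y :: real
  defines "A \<equiv> vector [vector [p, q], vector [q, r]] :: real^2^2"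
  shows "lambda_min A * (x\<^sup>2 + y\<^sup>2) \<le> p * x\<^sup>2 + 2 * q * x * y + r * y\<^sup>2"
    and "p * x\<^sup>2 + 2 * q * x * y + r * y\<^sup>2 \<le> lambda_max A * (x\<^sup>2 + y\<^sup>2)"
proof -
  define s where "s = sqrt ((p - r)\<^sup>2 + 4 * q\<^sup>2)"
  have "\<bar>p - r\<bar> \<le> s"
    unfolding s_def by (rule real_le_rsqrt) simp
  moreover have ss: "s * s = (p - r)\<^sup>2 + 4 * q\<^sup>2"
    by (simp add: s_def)
  moreover have l: "lambda_min A = (p + r - s) / 2" "lambda_max A = (p + r + s) / 2"
    using \<open>\<bar>p - r\<bar> \<le> s\<close>
    by (auto simp: lambda_min_def lambda_max_def A_def eigenvalues_sym_2 s_def)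
  ultimately have psd: "0 \<le> (p - r + s) / 2 * x\<^sup>2 + 2 * q * x * y + (r - p + s) / 2 * y\<^sup>2"
    "0 \<le> (r - p + s) / 2 * x\<^sup>2 + 2 * (- q) * x * y + (p - r + s) / 2 * y\<^sup>2"
    by (intro psd_form_2; auto simp: power2_eq_square field_simps)+
  show "lambda_min A * (x\<^sup>2 + y\<^sup>2) \<le> p * x\<^sup>2 + 2 * q * x * y + r * y\<^sup>2"
    using psd(1) unfolding l by (simp add: power2_eq_square field_simps)
  show "p * x\<^sup>2 + 2 * q * x * y + r * y\<^sup>2 \<le> lambda_max A * (x\<^sup>2 + y\<^sup>2)"
    using psd(2) unfolding l by (simp add: power2_eq_square field_simps)
qed

subsection \<open>Tracking a reference\<close>

lemma has_vector_derivative_matrix_mult: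
  fixes A :: "real \<Rightarrow> real^'n^'m" and B :: "real \<Rightarrow> real^'p^'n"
  assumes "(A has_vector_derivative A') (at t within S)" "(B has_vector_derivative B') (at t within S)"
  shows "((\<lambda>t. A t ** B t) has_vector_derivative A t ** B' + A' ** B t) (at t within S)"
  by (rule bounded_bilinear.has_vector_derivative[OF bounded_bilinear_matrix_mult assms])

lemma has_vector_derivative_linear:
  fixes F :: "'a::euclidean_space \<Rightarrow> 'b::real_normed_vector"
  assumes "linear F" "(f has_vector_derivative f') (at t within S)"
  shows "((\<lambda>t. F (f t)) has_vector_derivative F f') (at t within S)"
  using assms by (simp add: linear_conv_bounded_linear bounded_linear.has_vector_derivative)

text \<open>At interior points the one-sided derivative is the ordinary one; at 0 only continuity
  enters.\<close>

lemma nonincreasing_on_half_line: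
  fixes f :: "real \<Rightarrow> real"
  assumes f': "\<And>t. 0 \<le> t \<Longrightarrow> (f has_real_derivative f' t) (at t within {0..})"
    and le: "\<And>t. 0 \<le> t \<Longrightarrow> f' t \<le> 0" and "0 \<le> t"
  shows "f t \<le> f 0"
proof (rule DERIV_nonpos_imp_decreasing_open[OF \<open>0 \<le> t\<close>])
  fix x :: real assume "0 < x" "x < t"
  then have "at x within {0..} = at x"
    by (intro at_within_interior) simp
  then show "\<exists>y. (f has_real_derivative y) (at x) \<and> y \<le> 0"
    using f'[of x] le[of x] \<open>0 < x\<close> by auto
next
  have "continuous_on {0..} f"
    by (rule DERIV_continuous_on) (use f' in auto)
  then show "continuous_on {0..t} f"
    by (rule continuous_on_subset) auto
qed

text \<open>With \<open>g * g = (1 - a) * kR\<close> the bound on \<mu> is at most g, because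
  \<open>4 * g * k\<Omega> \<le> 4 * g\<^sup>2 + k\<Omega>\<^sup>2\<close>, and g is below
  \<open>sqrt kR\<close>. This makes the energy with the cross term comparable to
  \<open>V0\<close>.\<close>

lemma coupling_less_sqrt:
  fixes kR k\<Omega> a \<mu> :: real
  assumes "0 < kR" "0 < k\<Omega>" "0 < a" "a < 1"
    and \<mu>: "\<mu> < 4 * (1 - a) * kR * k\<Omega> / (4 * (1 - a) * kR + k\<Omega>\<^sup>2)"
  shows "\<mu> < sqrt kR"
proof -
  define g where "g = sqrt ((1 - a) * kR)"
  have g: "0 < g" "g * g = (1 - a) * kR"
    using assms by (auto simp: g_def)
  have "0 \<le> g * (2 * g - k\<Omega>)\<^sup>2"
    using g by simp
  then have "4 * (g * g) * k\<Omega> \<le> g * (4 * (g * g) + k\<Omega>\<^sup>2)"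
    by (simp add: power2_eq_square algebra_simps)
  moreover have "0 < 4 * (g * g) + k\<Omega>\<^sup>2"
    using assms(2) by (intro add_nonneg_pos) auto
  ultimately have "4 * (g * g) * k\<Omega> / (4 * (g * g) + k\<Omega>\<^sup>2) \<le> g"
    by (simp add: pos_divide_le_eq)
  then have "\<mu> < g"
    using \<mu> unfolding g(2) mult.assoc[symmetric] by linarith
  also have "g < sqrt kR"
    using assms by (simp add: g_def)
  finally show ?thesis .
qed

text \<open>The error dynamics left after the torque has cancelled the inertia and the feedforward.
  The reference is arbitrary, so the given and the shifted one are both instances.\<close>

definition tracking_motion ::
  "real \<Rightarrow> real \<Rightarrow> (real \<Rightarrow> real^3^3) \<Rightarrow> (real \<Rightarrow> real^3) \<Rightarrow> (real \<Rightarrow> real^3^3) \<Rightarrow> (real \<Rightarrow> real^3) \<Rightarrow> bool"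
  where "tracking_motion kR k\<Omega> Rd \<Omega>d R \<Omega> \<longleftrightarrow> (\<forall>t\<ge>0.
    rotation_matrix (Rd t) \<and> rotation_matrix (R t) \<and>
    (Rd has_vector_derivative Rd t ** hat (\<Omega>d t)) (at t within {0..}) \<and>
    (R has_vector_derivative R t ** hat (\<Omega> t)) (at t within {0..}) \<and>
    ((\<lambda>t. \<Omega> t - \<Omega>d t) has_vector_derivative
      - (kR *\<^sub>R e_R (Rd t) (R t)) - k\<Omega> *\<^sub>R (\<Omega> t - \<Omega>d t) + \<Omega> t \<times> \<Omega>d t) (at t within {0..}))"

text \<open>The quantity that decays at rate \<sigma> is \<open>V1\<close>, not \<open>V0\<close>.
  Passing from one to the other at both ends costs (1 + s) / (1 - s) with
  \<open>s = \<mu> / sqrt kR\<close>, which is the prefactor here.\<close>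

lemma tracking_energy_decay:
  fixes Rd R :: "real \<Rightarrow> real^3^3" and \<Omega>d \<Omega> :: "real \<Rightarrow> real^3"
  assumes motion: "tracking_motion kR k\<Omega> Rd \<Omega>d R \<Omega>"
    and pos: "0 < kR" "0 < k\<Omega>" "0 < a" "a < 1" "0 < \<mu>" "0 < \<sigma>"
    and \<mu>: "\<mu> < 4 * (1 - a) * kR * k\<Omega> / (4 * (1 - a) * kR + k\<Omega>\<^sup>2)"
    and \<sigma>: "\<sigma> = lambda_min (W3 kR k\<Omega> a \<mu>) / lambda_max (W2 kR \<mu>)"
    and init: "V0 kR Rd \<Omega>d (R 0) (\<Omega> 0) 0 \<le> 2 * a * kR"
    and "0 \<le> t"
  shows "V0 kR Rd \<Omega>d (R t) (\<Omega> t) t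
    \<le> (sqrt kR + \<mu>) / (sqrt kR - \<mu>) * exp (- \<sigma> * t) * V0 kR Rd \<Omega>d (R 0) (\<Omega> 0) 0"
proof -
  have rot: "rotation_matrix (Rd t)" "rotation_matrix (R t)"
    and dRd: "(Rd has_vector_derivative Rd t ** hat (\<Omega>d t)) (at t within {0..})"
    and dR: "(R has_vector_derivative R t ** hat (\<Omega> t)) (at t within {0..})"
    and d\<Omega>: "((\<lambda>t. \<Omega> t - \<Omega>d t) has_vector_derivative
      - (kR *\<^sub>R e_R (Rd t) (R t)) - k\<Omega> *\<^sub>R (\<Omega> t - \<Omega>d t) + \<Omega> t \<times> \<Omega>d t) (at t within {0..})"
    if "0 \<le> t" for t
    using motion that unfolding tracking_motion_def by auto
  define Q where "Q t = transpose (Rd t) ** R t" for t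
  define w where "w t = \<Omega> t - \<Omega>d t" for t
  define e where "e t = (1/2) *\<^sub>R axial (Q t)" for t
  define x where "x t = norm (R t - Rd t)" for t
  define y where "y t = norm (w t)" for t
  define V where "V t = V0 kR Rd \<Omega>d (R t) (\<Omega> t) t" for t
  define D where "D t = (trace (Q t) * (w t \<bullet> w t) - w t \<bullet> (Q t *v w t)) / 2
    - kR * (e t \<bullet> e t) - k\<Omega> * (e t \<bullet> w t)" for t
  define s where "s = \<mu> / sqrt kR"
  have s: "0 < s" "s < 1"
    using pos coupling_less_sqrt[OF pos(1-4) \<mu>] by (simp_all add: s_def)
  have e_eq: "e t = e_R (Rd t) (R t)" for t
    by (simp add: e_def Q_def e_R_eq_axial)
  have V_eq: "V t = kR / 4 * (x t)\<^sup>2 + 1 / 2 * (y t)\<^sup>2" for t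
    by (simp add: V_def V0_def x_def y_def w_def)
  have rotQ: "rotation_matrix (Q t)" if "0 \<le> t" for t
    unfolding Q_def using rot that by (intro rotation_matrix_mul rotation_matrix_transpose)
  have x_sq: "(x t)\<^sup>2 = 6 - 2 * trace (Q t)" if "0 \<le> t" for t
    unfolding x_def Q_def using that by (intro norm_rotation_diff_sq rot)
  have dQ: "(Q has_vector_derivative Q t ** hat (\<Omega> t) - hat (\<Omega>d t) ** Q t) (at t within {0..})"
    if "0 \<le> t" for t
  proof -
    have "(Q has_vector_derivative transpose (Rd t) ** (R t ** hat (\<Omega> t))
        + transpose (Rd t ** hat (\<Omega>d t)) ** R t) (at t within {0..})"
      unfolding Q_def
      by (intro has_vector_derivative_matrix_mult has_vector_derivative_linear[OF linear_transpose]
          dR dRd that)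
    also have "transpose (Rd t) ** (R t ** hat (\<Omega> t)) = Q t ** hat (\<Omega> t)"
      by (simp add: Q_def matrix_mul_assoc)
    also have "transpose (Rd t ** hat (\<Omega>d t)) ** R t = - (hat (\<Omega>d t) ** Q t)"
      by (simp add: Q_def vec_eq_iff forall_3 mat3_simps algebra_simps)
    finally show ?thesis
      by simp
  qed
  have dw: "(w has_vector_derivative - (kR *\<^sub>R e t) - k\<Omega> *\<^sub>R w t + \<Omega> t \<times> \<Omega>d t) (at t within {0..})"
    if "0 \<le> t" for t
    using d\<Omega>[OF that] by (simp add: w_def[abs_def] e_eq)
  \<comment> \<open>The trace contributes \<open>kR * (e t \<bullet> w t)\<close>, which cancels the
    work of the proportional feedback; only the damping survives.\<close>
  have dV: "(V has_real_derivative - k\<Omega> * (y t)\<^sup>2) (at t within {0..})" if "0 \<le> t" for t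
  proof -
    have "((\<lambda>t. kR / 4 * (6 - 2 * trace (Q t)) + 1 / 2 * (w t \<bullet> w t)) has_real_derivative
        kR / 4 * (- 2 * trace (Q t ** hat (\<Omega> t) - hat (\<Omega>d t) ** Q t))
        + w t \<bullet> (- (kR *\<^sub>R e t) - k\<Omega> *\<^sub>R w t + \<Omega> t \<times> \<Omega>d t)) (at t within {0..})"
      by (rule derivative_eq_intros
          has_vector_derivative_linear[OF linear_trace dQ[OF that],
            folded has_real_derivative_iff_has_vector_derivative]
          bounded_bilinear.has_vector_derivative[OF bounded_bilinear_inner dw[OF that] dw[OF that],
            folded has_real_derivative_iff_has_vector_derivative] refl)+
        (simp add: inner_commute)
    moreover have "kR / 4 * (- 2 * trace (Q t ** hat (\<Omega> t) - hat (\<Omega>d t) ** Q t))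
        + w t \<bullet> (- (kR *\<^sub>R e t) - k\<Omega> *\<^sub>R w t + \<Omega> t \<times> \<Omega>d t) = - k\<Omega> * (y t)\<^sup>2"
      unfolding trace_error_dynamics w_def velocity_error_power
      by (simp add: e_def y_def w_def power2_norm_eq_inner)
    ultimately have "((\<lambda>t. kR / 4 * (6 - 2 * trace (Q t)) + 1 / 2 * (w t \<bullet> w t)) has_real_derivative
        - k\<Omega> * (y t)\<^sup>2) (at t within {0..})"
      by simp
    \<comment> \<open>The trace formula for V is valid at nonnegative times only, so the derivative
      is transferred within the half line.\<close>
    then show ?thesis
      by (rule has_field_derivative_transform_within[OF _ zero_less_one])
        (use that in \<open>simp_all add: V_eq x_sq y_def power2_norm_eq_inner\<close>)
  qed
  have de: "(e has_vector_derivative (1/2) *\<^sub>R axial (Q t ** hat (\<Omega> t) - hat (\<Omega>d t) ** Q t))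
      (at t within {0..})" if "0 \<le> t" for t
    unfolding e_def
    by (intro bounded_linear.has_vector_derivative[OF bounded_linear_scaleR_right]
        has_vector_derivative_linear[OF linear_axial] dQ that)
  have dew: "((\<lambda>t. e t \<bullet> w t) has_real_derivative D t) (at t within {0..})" if "0 \<le> t" for t
  proof -
    have "((\<lambda>t. e t \<bullet> w t) has_real_derivative
        e t \<bullet> (- (kR *\<^sub>R e t) - k\<Omega> *\<^sub>R w t + \<Omega> t \<times> \<Omega>d t)
        + (1/2) *\<^sub>R axial (Q t ** hat (\<Omega> t) - hat (\<Omega>d t) ** Q t) \<bullet> w t) (at t within {0..})"
      unfolding has_real_derivative_iff_has_vector_derivative
      by (intro bounded_bilinear.has_vector_derivative[OF bounded_bilinear_inner] de dw that)
    then show ?thesis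
      using cross_term_dynamics[of "Q t" "\<Omega> t" "\<Omega>d t" kR k\<Omega>]
      by (simp only: D_def w_def e_def add.commute)
  qed
  have V_le: "V t \<le> 2 * a * kR" if "0 \<le> t" for t
    using nonincreasing_on_half_line[OF dV _ that] init pos by (fastforce simp: V_def)
  have x_le: "(x t)\<^sup>2 \<le> 8 * a" if "0 \<le> t" for t
  proof -
    have "kR / 4 * (x t)\<^sup>2 \<le> 2 * a * kR"
      using V_le[OF that] zero_le_power2[of "y t"] unfolding V_eq by linarith
    then show ?thesis
      using pos by simp
  qed
  have ee: "e t \<bullet> e t = (x t)\<^sup>2 / 2 * (1 - (x t)\<^sup>2 / 8)" if "0 \<le> t" for t
    using norm_e_R_sq[OF rot(2)[OF that] rot(1)[OF that]]
    by (simp add: e_eq x_def power2_norm_eq_inner)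
  \<comment> \<open>Dropping the factor 1 - x^2/8 \<le> 1 from \<open>ee\<close> leaves |e| \<le> x
    / sqrt 2; this is where the sqrt 2 in the off-diagonal entries of \<open>W2\<close> and
    \<open>W3\<close> comes from.\<close>
  have ew: "\<bar>e t \<bullet> w t\<bar> \<le> x t * y t / sqrt 2" if "0 \<le> t" for t
  proof -
    have "(norm (e t))\<^sup>2 \<le> (x t / sqrt 2)\<^sup>2"
      by (simp add: power2_norm_eq_inner ee[OF that] power_divide mult_left_le)
    then have "norm (e t) \<le> x t / sqrt 2"
      by (rule power2_le_imp_le) (simp add: x_def)
    then have "norm (e t) * y t \<le> x t / sqrt 2 * y t"
      by (rule mult_right_mono) (simp add: y_def)
    then show ?thesis
      using Cauchy_Schwarz_ineq2[of "e t" "w t"] by (simp add: y_def)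
  qed
  \<comment> \<open>Arithmetic-geometric mean: V minus \<open>sqrt kR * (x t * y t / sqrt 2)\<close>
    is a complete square.\<close>
  have \<mu>ew: "\<mu> * \<bar>e t \<bullet> w t\<bar> \<le> s * V t" if "0 \<le> t" for t
  proof -
    have "0 \<le> (sqrt kR * x t / 2 - y t / sqrt 2)\<^sup>2"
      by simp
    also have "\<dots> = V t - sqrt kR * (x t * y t / sqrt 2)"
      using pos by (simp add: V_eq power2_diff power_divide power_mult_distrib)
    finally have "sqrt kR * \<bar>e t \<bullet> w t\<bar> \<le> V t"
      using mult_left_mono[OF ew[OF that], of "sqrt kR"] pos by simp
    then have "s * (sqrt kR * \<bar>e t \<bullet> w t\<bar>) \<le> s * V t"
      using s by simp
    then show ?thesis
      using pos by (simp add: s_def)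
  qed

  \<comment> \<open>The energy with cross term and its decay\<close>
  define V1 where "V1 t = V t + \<mu> * (e t \<bullet> w t)" for t
  have V1_bounds: "(1 - s) * V t \<le> V1 t" "V1 t \<le> (1 + s) * V t" if "0 \<le> t" for t
  proof -
    have "\<bar>\<mu> * (e t \<bullet> w t)\<bar> \<le> s * V t"
      using \<mu>ew[OF that] pos by (simp add: abs_mult)
    then show "(1 - s) * V t \<le> V1 t" "V1 t \<le> (1 + s) * V t"
      by (simp_all add: V1_def algebra_simps abs_le_iff)
  qed
  have lmax: "kR / 4 * X\<^sup>2 + \<mu> * (X * Y / sqrt 2) + 1 / 2 * Y\<^sup>2 \<le> lambda_max (W2 kR \<mu>) * (X\<^sup>2 + Y\<^sup>2)"
    for X Y
    using quadratic_form_bounds_sym_2(2)[of "kR / 4" X "\<mu> / (2 * sqrt 2)" Y "1 / 2"]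
    by (simp add: W2_def)
  have lmin: "lambda_min (W3 kR k\<Omega> a \<mu>) * (X\<^sup>2 + Y\<^sup>2)
      \<le> (1 - a) / 2 * \<mu> * kR * X\<^sup>2 - \<mu> * k\<Omega> * (X * Y / sqrt 2) + (k\<Omega> - \<mu>) * Y\<^sup>2" for X Y
    using quadratic_form_bounds_sym_2(1)[of "(1 - a) / 2 * \<mu> * kR" "- (\<mu> * k\<Omega> / (2 * sqrt 2))" "k\<Omega> - \<mu>" X Y]
    by (simp add: W3_def algebra_simps)
  \<comment> \<open>Evaluating the form of \<open>W2\<close> at (1, 0) gives the lower bound kR /
    4.\<close>
  have lmax_pos: "0 < lambda_max (W2 kR \<mu>)"
    using lmax[of 1 0] pos by simp
  \<comment> \<open>The form of \<open>W2\<close> at (x, y) bounds \<open>V1\<close> from above, and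
    that of \<open>W3\<close> bounds minus the derivative of \<open>V1\<close> from below. The
    choice of \<sigma> turns the largest eigenvalue of the first into the smallest of the
    second.\<close>
  have V1'_le: "- k\<Omega> * (y t)\<^sup>2 + \<mu> * D t \<le> - \<sigma> * V1 t" if "0 \<le> t" for t
  proof -
    have "V1 t \<le> lambda_max (W2 kR \<mu>) * ((x t)\<^sup>2 + (y t)\<^sup>2)"
      using lmax[of "x t" "y t"] mult_left_mono[OF ew[OF that], of \<mu>] pos
      by (simp add: V1_def V_eq) (smt (verit) mult_left_mono)
    then have "\<sigma> * V1 t \<le> \<sigma> * (lambda_max (W2 kR \<mu>) * ((x t)\<^sup>2 + (y t)\<^sup>2))"
      using pos by simp
    also have "\<dots> = lambda_min (W3 kR k\<Omega> a \<mu>) * ((x t)\<^sup>2 + (y t)\<^sup>2)"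
      using lmax_pos by (simp add: \<sigma>)
    also have "\<dots> \<le> (1 - a) / 2 * \<mu> * kR * (x t)\<^sup>2 - \<mu> * k\<Omega> * (x t * y t / sqrt 2) + (k\<Omega> - \<mu>) * (y t)\<^sup>2"
      by (rule lmin)
    also have "\<dots> \<le> k\<Omega> * (y t)\<^sup>2 - \<mu> * D t"
    proof -
      \<comment> \<open>The three terms of \<open>D t\<close> yield the entries of
        \<open>W3\<close>: the quadratic form in w costs \<mu> in the damping entry,
        \<open>x_le\<close> leaves the factor 1 - a in the attitude entry, and \<open>ew\<close>
        bounds the mixed term.\<close>
      have 1: "(trace (Q t) * (w t \<bullet> w t) - w t \<bullet> (Q t *v w t)) / 2 \<le> (y t)\<^sup>2"
        using rotation_quadratic_form_le[OF rotQ[OF that], of "w t"]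
        by (simp add: y_def power2_norm_eq_inner)
      have "(x t)\<^sup>2 / 2 * (1 - a) \<le> e t \<bullet> e t"
        unfolding ee[OF that] using x_le[OF that] by (intro mult_left_mono) auto
      then have 2: "kR * ((x t)\<^sup>2 / 2 * (1 - a)) \<le> kR * (e t \<bullet> e t)"
        using pos by simp
      have 3: "- (k\<Omega> * (e t \<bullet> w t)) \<le> k\<Omega> * (x t * y t / sqrt 2)"
        using mult_left_mono[of "- (e t \<bullet> w t)" "x t * y t / sqrt 2" k\<Omega>] ew[OF that] pos
        by simp
      have "D t \<le> (y t)\<^sup>2 - kR * ((x t)\<^sup>2 / 2 * (1 - a)) + k\<Omega> * (x t * y t / sqrt 2)"
        unfolding D_def using 1 2 3 by linarith
      then have "\<mu> * D t \<le> \<mu> * ((y t)\<^sup>2 - kR * ((x t)\<^sup>2 / 2 * (1 - a)) + k\<Omega> * (x t * y t / sqrt 2))"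
        using pos by simp
      then show ?thesis
        by (simp add: algebra_simps)
    qed
    finally show ?thesis
      by simp
  qed
  \<comment> \<open>Integrating factor: by \<open>V1'_le\<close> this derivative is
    nonpositive.\<close>
  have "((\<lambda>t. V1 t * exp (\<sigma> * t)) has_real_derivative
      (- k\<Omega> * (y t)\<^sup>2 + \<mu> * D t + \<sigma> * V1 t) * exp (\<sigma> * t)) (at t within {0..})" if "0 \<le> t" for t
    unfolding V1_def
    by (rule derivative_eq_intros dV[OF that] dew[OF that] refl)+ (simp add: algebra_simps)
  from nonincreasing_on_half_line[OF this _ \<open>0 \<le> t\<close>]
  have "V1 t * exp (\<sigma> * t) \<le> V1 0"
    using V1'_le by (fastforce simp: mult_le_0_iff)
  then have "V1 t \<le> exp (- \<sigma> * t) * V1 0"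
    by (simp add: exp_minus field_simps)
  also have "\<dots> \<le> exp (- \<sigma> * t) * ((1 + s) * V 0)"
    using V1_bounds(2)[of 0] by simp
  finally have "(1 - s) * V t \<le> exp (- \<sigma> * t) * ((1 + s) * V 0)"
    using V1_bounds(1)[OF \<open>0 \<le> t\<close>] by linarith
  then have "V t \<le> (1 + s) / (1 - s) * exp (- \<sigma> * t) * V 0"
    using s by (simp add: field_simps)
  also have "(1 + s) / (1 - s) = (sqrt kR + \<mu>) / (sqrt kR - \<mu>)"
    using pos by (simp add: s_def divide_simps)
  finally show ?thesis
    by (simp add: V_def)
qed

lemmas matrix_mult_linear =
  bounded_bilinear.scaleR_left[OF bounded_bilinear_matrix_mult]
  bounded_bilinear.scaleR_right[OF bounded_bilinear_matrix_mult]
  bounded_bilinear.zero_left[OF bounded_bilinear_matrix_mult]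
  bounded_bilinear.zero_right[OF bounded_bilinear_matrix_mult]

lemma V0_nonneg: "0 \<le> kR \<Longrightarrow> 0 \<le> V0 kR Rd \<Omega>d R \<Omega> t"
  by (simp add: V0_def)

section \<open>Comparing energy and error norms\<close>

lemma error_sq_le_energy:
  assumes "0 < kR"
  shows "(norm (R - Rd t) + norm (\<Omega> - \<Omega>d t))\<^sup>2 \<le> 2 / min (kR / 4) (1 / 2) * V0 kR Rd \<Omega>d R \<Omega> t"
proof -
  define x y m where "x = norm (R - Rd t)" and "y = norm (\<Omega> - \<Omega>d t)" and "m = min (kR / 4) (1 / 2)"
  have "0 < m"
    using assms by (simp add: m_def)
  have "m * (x\<^sup>2 + y\<^sup>2) \<le> kR / 4 * x\<^sup>2 + 1 / 2 * y\<^sup>2"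
    unfolding distrib_left by (intro add_mono mult_right_mono) (simp_all add: m_def)
  then have "2 * (x\<^sup>2 + y\<^sup>2) \<le> 2 / m * (kR / 4 * x\<^sup>2 + 1 / 2 * y\<^sup>2)"
    using \<open>0 < m\<close> by (simp add: field_simps)
  moreover have "(x + y)\<^sup>2 \<le> 2 * (x\<^sup>2 + y\<^sup>2)"
    using zero_le_power2[of "x - y"] by (simp add: power2_eq_square algebra_simps)
  ultimately show ?thesis
    unfolding V0_def x_def y_def m_def by linarith
qed

lemma energy_le_error_sq:
  assumes "0 < kR"
  shows "V0 kR Rd \<Omega>d R \<Omega> t \<le> (kR / 4 + 1 / 2) * (norm (R - Rd t) + norm (\<Omega> - \<Omega>d t))\<^sup>2"
proof -
  define x y where "x = norm (R - Rd t)" and "y = norm (\<Omega> - \<Omega>d t)"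
  have "x\<^sup>2 \<le> (x + y)\<^sup>2" "y\<^sup>2 \<le> (x + y)\<^sup>2"
    by (intro power_mono; simp add: x_def y_def)+
  then have "kR / 4 * x\<^sup>2 + 1 / 2 * y\<^sup>2 \<le> kR / 4 * (x + y)\<^sup>2 + 1 / 2 * (x + y)\<^sup>2"
    using assms by (intro add_mono mult_left_mono) auto
  then show ?thesis
    unfolding V0_def x_def y_def distrib_right .
qed

text \<open>Taking square roots of the energy estimate halves the rate. The bound keeps the initial
  energy: case (a) estimates it by the initial error, whereas case (b) has only the level
  \<open>2 * a * kR\<close> of the shifted energy.\<close>

lemma tracking_error_decay:
  assumes motion: "tracking_motion kR k\<Omega> Rd \<Omega>d R \<Omega>"
    and pos: "0 < kR" "0 < k\<Omega>" "0 < a" "a < 1" "0 < \<mu>" "0 < \<sigma>"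
    and \<mu>: "\<mu> < 4 * (1 - a) * kR * k\<Omega> / (4 * (1 - a) * kR + k\<Omega>\<^sup>2)"
    and \<sigma>: "\<sigma> = lambda_min (W3 kR k\<Omega> a \<mu>) / lambda_max (W2 kR \<mu>)"
    and init: "V0 kR Rd \<Omega>d (R 0) (\<Omega> 0) 0 \<le> 2 * a * kR"
    and "0 \<le> t"
  shows "norm (R t - Rd t) + norm (\<Omega> t - \<Omega>d t)
    \<le> sqrt (2 / min (kR / 4) (1 / 2) * ((sqrt kR + \<mu>) / (sqrt kR - \<mu>)) * V0 kR Rd \<Omega>d (R 0) (\<Omega> 0) 0)
      * exp (- (\<sigma> / 2) * t)" (is "?l \<le> sqrt (?m * ?K * ?V) * ?e")
proof -
  have "?l\<^sup>2 \<le> ?m * V0 kR Rd \<Omega>d (R t) (\<Omega> t) t"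
    by (rule error_sq_le_energy[OF pos(1)])
  also have "\<dots> \<le> ?m * (?K * exp (- \<sigma> * t) * ?V)"
    by (intro mult_left_mono tracking_energy_decay[OF motion pos \<mu> \<sigma> init \<open>0 \<le> t\<close>]) (use pos in simp)
  also have "\<dots> = ?m * ?K * ?V * ?e\<^sup>2"
    by (simp add: power2_eq_square flip: exp_add)
  finally have "sqrt (?l\<^sup>2) \<le> sqrt (?m * ?K * ?V * ?e\<^sup>2)"
    by (rule real_sqrt_le_mono)
  also have "\<dots> = sqrt (?m * ?K * ?V) * ?e"
    by (subst real_sqrt_mult) simp
  finally show ?thesis
    by simp
qed

text \<open>Positive definiteness makes J injective, so J can be cancelled from the Euler equation
  once the torque has removed the gyroscopic moment.\<close>

lemma tracking_motionI:
  assumes J: "spd_matrix J"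
    and motion: "rigid_body_motion J \<tau> R \<Omega>"
    and \<tau>: "\<And>t. 0 \<le> t \<Longrightarrow> \<tau> t = tracking_torque J kR k\<Omega> Rd \<Omega>d (R t) (\<Omega> t) t"
    and Rd: "\<And>t. 0 \<le> t \<Longrightarrow> rotation_matrix (Rd t)"
      "\<And>t. 0 \<le> t \<Longrightarrow> (Rd has_vector_derivative Rd t ** hat (\<Omega>d t)) (at t within {0..})"
    and \<Omega>d: "\<And>t. 0 \<le> t \<Longrightarrow> \<Omega>d differentiable (at t within {0..})"
  shows "tracking_motion kR k\<Omega> Rd \<Omega>d R \<Omega>"
  unfolding tracking_motion_def
proof (intro allI impI conjI)
  fix t :: real assume t: "0 \<le> t"
  define u where "u = - (kR *\<^sub>R e_R (Rd t) (R t)) - k\<Omega> *\<^sub>R (\<Omega> t - \<Omega>d t) + \<Omega> t \<times> \<Omega>d t"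
  have "J *v dt \<Omega> t = J *v (u + dt \<Omega>d t)"
    using motion t \<tau>[OF t] by (simp add: rigid_body_motion_def tracking_torque_def u_def)
  then have "J *v (dt \<Omega> t - (u + dt \<Omega>d t)) = 0"
    by (simp add: matrix_vector_mult_diff_distrib)
  then have "dt \<Omega> t - (u + dt \<Omega>d t) = 0"
    using J unfolding spd_matrix_def by (metis inner_zero_right less_irrefl)
  moreover have "(\<Omega> has_vector_derivative dt \<Omega> t) (at t within {0..})"
    "(\<Omega>d has_vector_derivative dt \<Omega>d t) (at t within {0..})"
    using motion t \<Omega>d[OF t] unfolding dt_def rigid_body_motion_def
    by (auto simp: vector_derivative_works[symmetric])
  from has_vector_derivative_diff[OF this]
  show "((\<lambda>t. \<Omega> t - \<Omega>d t) has_vector_derivative u) (at t within {0..})"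
    using calculation by (simp add: algebra_simps)
qed (use motion Rd in \<open>auto simp: rigid_body_motion_def\<close>)

subsection \<open>The shifted reference\<close>

text \<open>A nontrivial filter is what makes one-sided derivatives unique, so that
  \<open>dt\<close> can be evaluated, also at time 0.\<close>

lemma at_within_half_line_neq_bot:
  fixes t :: real
  assumes "0 \<le> t"
  shows "at t within {0..} \<noteq> bot"
proof
  have "{t<..} \<subseteq> {0..}"
    using assms by auto
  moreover assume "at t within {0..} = bot"
  ultimately have "at_right t = bot"
    using at_le[of "{t<..}" "{0..}" t] by (simp add: bot.extremum_unique)
  then show False
    by simp
qed

text \<open>Rodrigues' formula: \<open>A ** A ** A = - A\<close>, so the exponential series
  separates into the sine and the cosine series.\<close>

lemma Z_rot_eq:
  fixes \<theta> :: real
  defines "A \<equiv> hat (axis 3 1)"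
  shows "Z_rot \<theta> = mat 1 + sin \<theta> *\<^sub>R A + (1 - cos \<theta>) *\<^sub>R (A ** A)"
proof -
  \<comment> \<open>The n = 0 summand corrects the start: the cosine series alone would give
    \<open>- (A ** A)\<close> there instead of \<open>mat 1\<close>.\<close>
  have pow: "(((**) (\<theta> *\<^sub>R A)) ^^ n) (mat 1) = fact n *\<^sub>R
      ((if n = 0 then mat 1 + A ** A else 0) + (sin_coeff n *\<^sub>R \<theta> ^ n) *\<^sub>R A
       - (cos_coeff n *\<^sub>R \<theta> ^ n) *\<^sub>R (A ** A))" for n
  proof (induction n)
    case 0
    then show ?case by simp
  next
    case (Suc n)
    have "A ** mat 1 = A" "A ** (A ** A) = - A"
      by (simp_all add: A_def vec_eq_iff forall_3 mat3_simps axis_def)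
    \<comment> \<open>Multiplication by A annihilates \<open>mat 1 + A ** A\<close> and exchanges
      the sine and cosine coefficients, as passing from n to n + 1 requires.\<close>
    then have A: "A ** (c *\<^sub>R (mat 1 + A ** A) + p *\<^sub>R A - q *\<^sub>R (A ** A)) = q *\<^sub>R A + p *\<^sub>R (A ** A)" for c p q
      by (simp add: A_def vec_eq_iff forall_3 mat3_simps axis_def mat_def)
    have "(((**) (\<theta> *\<^sub>R A)) ^^ Suc n) (mat 1) = (fact n * \<theta>) *\<^sub>R
      (A ** ((if n = 0 then 1 else 0) *\<^sub>R (mat 1 + A ** A) + (sin_coeff n * \<theta> ^ n) *\<^sub>R A
       - (cos_coeff n * \<theta> ^ n) *\<^sub>R (A ** A)))"
      by (simp add: Suc.IH) (simp add: vec_eq_iff forall_3 mat3_simps algebra_simps)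
    also have "\<dots> = fact (Suc n) *\<^sub>R ((sin_coeff (Suc n) * \<theta> ^ Suc n) *\<^sub>R A
       - (cos_coeff (Suc n) * \<theta> ^ Suc n) *\<^sub>R (A ** A))"
    proof -
      have "fact (Suc n) * (cos_coeff n / real (Suc n) * \<theta> ^ Suc n) = fact n * \<theta> * (cos_coeff n * \<theta> ^ n)"
        "fact (Suc n) * (- sin_coeff n / real (Suc n) * \<theta> ^ Suc n) = - (fact n * \<theta> * (sin_coeff n * \<theta> ^ n))"
        by (simp_all add: field_simps)
      then show ?thesis
        unfolding A sin_coeff_Suc cos_coeff_Suc
        by (simp only: scaleR_right_diff_distrib scaleR_right_distrib scaleR_scaleR
            scaleR_minus_left diff_minus_eq_add)
    qed
    finally show ?case by simp
  qed
  have "(\<lambda>n. (if n = 0 then mat 1 + A ** A else 0) + (sin_coeff n *\<^sub>R \<theta> ^ n) *\<^sub>R A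
       - (cos_coeff n *\<^sub>R \<theta> ^ n) *\<^sub>R (A ** A))
     sums ((mat 1 + A ** A) + sin \<theta> *\<^sub>R A - cos \<theta> *\<^sub>R (A ** A))"
    by (intro sums_add sums_diff sums_scaleR_left sin_converges cos_converges
        sums_single[of 0 "\<lambda>_. mat 1 + A ** A"])
  then have "Z_rot \<theta> = (mat 1 + A ** A) + sin \<theta> *\<^sub>R A - cos \<theta> *\<^sub>R (A ** A)"
    unfolding Z_rot_def matrix_exp_def A_def[symmetric] pow by (simp add: sums_iff)
  then show ?thesis
    by (simp add: algebra_simps)
qed

lemma Z_rot_components [simp]:
  "Z_rot \<theta> $ 1 $ 1 = cos \<theta>" "Z_rot \<theta> $ 1 $ 2 = - sin \<theta>" "Z_rot \<theta> $ 1 $ 3 = 0"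
  "Z_rot \<theta> $ 2 $ 1 = sin \<theta>" "Z_rot \<theta> $ 2 $ 2 = cos \<theta>" "Z_rot \<theta> $ 2 $ 3 = 0"
  "Z_rot \<theta> $ 3 $ 1 = 0" "Z_rot \<theta> $ 3 $ 2 = 0" "Z_rot \<theta> $ 3 $ 3 = 1"
  by (simp_all add: Z_rot_eq mat3_simps axis_def mat_def)

lemma rotation_matrix_Z_rot: "rotation_matrix (Z_rot \<theta>)"
  using sin_cos_squared_add3[of \<theta>]
  by (simp add: rotation_matrix_def orthogonal_matrix det_3 vec_eq_iff forall_3 mat3_simps mat_def algebra_simps)

lemma has_vector_derivative_Z_rot:
  assumes "(f has_real_derivative f') (at t within S)"
  shows "((\<lambda>t. Z_rot (f t)) has_vector_derivative f' *\<^sub>R (hat (axis 3 1) ** Z_rot (f t))) (at t within S)"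
proof -
  define A where "A = hat (axis 3 1)"
  have "((\<lambda>t. mat 1 + sin (f t) *\<^sub>R A + (1 - cos (f t)) *\<^sub>R (A ** A)) has_vector_derivative
      (cos (f t) * f') *\<^sub>R A + (sin (f t) * f') *\<^sub>R (A ** A)) (at t within S)"
    by (rule derivative_eq_intros assms refl)+ simp
  moreover have "(cos (f t) * f') *\<^sub>R A + (sin (f t) * f') *\<^sub>R (A ** A) = f' *\<^sub>R (A ** Z_rot (f t))"
    by (simp add: A_def vec_eq_iff forall_3 mat3_simps axis_def)
  ultimately show ?thesis
    by (simp add: Z_rot_eq A_def)
qed

text \<open>Rotations preserve the cross product; apply this to v and
  \<open>transpose A *v x\<close>.\<close>

lemma hat_rotation:
  assumes "rotation_matrix A"
  shows "hat (A *v v) = A ** hat v ** transpose A"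
proof -
  have "(A *v v) \<times> x = A *v (v \<times> (transpose A *v x))" for x
    using cross_rotation_matrix[OF assms, of v "transpose A *v x"]
    unfolding matrix_vector_mul_assoc rotation_matrixD[OF assms] by simp
  then show ?thesis
    by (simp add: matrix_eq hat_mult_vec flip: matrix_vector_mul_assoc)
qed

lemma has_real_derivative_theta_b:
  "(theta_b \<theta>b0 \<gamma> has_real_derivative - (\<gamma> / 2) * theta_b \<theta>b0 \<gamma> t) (at t within S)"
  unfolding theta_b_def[abs_def] by (rule derivative_eq_intros refl)+ simp

lemma dt_theta_b: "0 \<le> t \<Longrightarrow> dt (theta_b \<theta>b0 \<gamma>) t = - (\<gamma> / 2) * theta_b \<theta>b0 \<gamma> t"
  unfolding dt_def
  by (intro vector_derivative_within at_within_half_line_neq_bot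
      has_real_derivative_theta_b[unfolded has_real_derivative_iff_has_vector_derivative])

context
  fixes Rd :: "real \<Rightarrow> real^3^3" and \<Omega>d :: "real \<Rightarrow> real^3" and U :: "real^3^3"
  assumes rot_Rd: "\<And>t. 0 \<le> t \<Longrightarrow> rotation_matrix (Rd t)"
    and rot_U: "rotation_matrix U"
    and dRd: "\<And>t. 0 \<le> t \<Longrightarrow> (Rd has_vector_derivative Rd t ** hat (\<Omega>d t)) (at t within {0..})"
    and d\<Omega>d: "\<And>t. 0 \<le> t \<Longrightarrow> \<Omega>d differentiable (at t within {0..})"
begin

lemma rotation_matrix_shifted_Rd:
  "0 \<le> t \<Longrightarrow> rotation_matrix (shifted_Rd \<theta>b0 \<gamma> U Rd t)"
  unfolding shifted_Rd_def
  by (intro rotation_matrix_mul rotation_matrix_transpose rotation_matrix_Z_rot rot_U rot_Rd)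

text \<open>The moving factor adds the angular velocity \<theta>' U e3 on the left of the shifted
  attitude S. Conjugation by S, through \<open>hat_rotation\<close>, moves it to the right as
  \<theta>' S^T U e3, the correction in \<open>shifted_\<Omega>d\<close>.\<close>

lemma shifted_Rd_has_vector_derivative:
  assumes t: "0 \<le> t"
  shows "(shifted_Rd \<theta>b0 \<gamma> U Rd has_vector_derivative
    shifted_Rd \<theta>b0 \<gamma> U Rd t ** hat (shifted_\<Omega>d \<theta>b0 \<gamma> U Rd \<Omega>d t)) (at t within {0..})"
proof -
  define S where "S = shifted_Rd \<theta>b0 \<gamma> U Rd t"
  define Z where "Z = Z_rot (theta_b \<theta>b0 \<gamma> t)"
  define f' where "f' = dt (theta_b \<theta>b0 \<gamma>) t"
  define A where "A = hat (axis 3 1)"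
  have S: "rotation_matrix S"
    unfolding S_def by (rule rotation_matrix_shifted_Rd[OF t])
  have "(theta_b \<theta>b0 \<gamma> has_real_derivative f') (at t within {0..})"
    unfolding f'_def dt_theta_b[OF t] by (rule has_real_derivative_theta_b)
  then have Z: "((\<lambda>t. Z_rot (theta_b \<theta>b0 \<gamma> t)) has_vector_derivative f' *\<^sub>R (A ** Z)) (at t within {0..})"
    unfolding A_def Z_def by (rule has_vector_derivative_Z_rot)
  have "(shifted_Rd \<theta>b0 \<gamma> U Rd has_vector_derivative
      U ** Z ** transpose U ** (Rd t ** hat (\<Omega>d t)) + (U ** Z ** 0 + (U ** (f' *\<^sub>R (A ** Z)) + 0 ** Z) ** transpose U) ** Rd t)
      (at t within {0..})"
    unfolding Z_def shifted_Rd_def[abs_def]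
    by (intro has_vector_derivative_matrix_mult has_vector_derivative_const dRd t Z[unfolded Z_def])
  moreover have "U ** Z ** transpose U ** (Rd t ** hat (\<Omega>d t))
      + (U ** Z ** 0 + (U ** (f' *\<^sub>R (A ** Z)) + 0 ** Z) ** transpose U) ** Rd t
    = S ** hat (\<Omega>d t) + f' *\<^sub>R (U ** A ** Z ** transpose U ** Rd t)"
    by (simp add: S_def Z_def shifted_Rd_def matrix_mul_assoc matrix_mult_linear)
  moreover have "U ** A ** Z ** transpose U ** Rd t = S ** hat (transpose S *v (U *v axis 3 1))"
  proof -
    have "S ** hat (transpose S *v (U *v axis 3 1)) = S ** transpose S ** hat (U *v axis 3 1) ** S"
      unfolding hat_rotation[OF rotation_matrix_transpose[OF S]] by (simp add: matrix_mul_assoc)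
    also have "\<dots> = U ** A ** (transpose U ** U) ** Z ** transpose U ** Rd t"
      unfolding rotation_matrixD[OF S] hat_rotation[OF rot_U]
      by (simp add: A_def S_def Z_def shifted_Rd_def matrix_mul_assoc)
    finally show ?thesis
      by (simp add: rotation_matrixD[OF rot_U])
  qed
  moreover have "S ** hat (shifted_\<Omega>d \<theta>b0 \<gamma> U Rd \<Omega>d t)
      = S ** hat (\<Omega>d t) + f' *\<^sub>R (S ** hat (transpose S *v (U *v axis 3 1)))"
    unfolding shifted_\<Omega>d_def S_def[symmetric] f'_def[symmetric]
    by (simp add: vec_eq_iff forall_3 mat3_mult_component algebra_simps)
  ultimately show ?thesis
    unfolding S_def by simp
qed

text \<open>For nonnegative times the \<open>dt\<close> term has the closed form
  \<open>dt_theta_b\<close>; with it the signal is assembled from differentiable pieces.\<close>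

lemma shifted_\<Omega>d_differentiable:
  assumes t: "0 \<le> t"
  shows "shifted_\<Omega>d \<theta>b0 \<gamma> U Rd \<Omega>d differentiable (at t within {0..})"
proof -
  define f where "f t = - (\<gamma> / 2) * theta_b \<theta>b0 \<gamma> t" for t
  define g where "g t = transpose (shifted_Rd \<theta>b0 \<gamma> U Rd t) *v (U *v axis 3 1)" for t
  have "((\<lambda>t. - (\<gamma> / 2) * theta_b \<theta>b0 \<gamma> t) has_real_derivative
      - (\<gamma> / 2) * (- (\<gamma> / 2) * theta_b \<theta>b0 \<gamma> t)) (at t within {0..})"
    by (intro DERIV_cmult has_real_derivative_theta_b)
  then have "f differentiable (at t within {0..})"
    unfolding f_def[abs_def] has_real_derivative_iff_has_vector_derivative
    by (rule differentiableI_vector)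
  moreover have "g differentiable (at t within {0..})"
    unfolding g_def[abs_def]
    by (rule differentiableI_vector, rule bounded_bilinear.has_vector_derivative[OF bounded_bilinear_matrix_vector_mult])
      (rule has_vector_derivative_const has_vector_derivative_linear[OF linear_transpose]
        shifted_Rd_has_vector_derivative t)+
  ultimately have "(\<lambda>t. \<Omega>d t + f t *\<^sub>R g t) differentiable (at t within {0..})"
    using d\<Omega>d[OF t] by (intro differentiable_add differentiable_scaleR)
  then show ?thesis
    by (rule differentiable_transform_within[OF _ zero_less_one])
      (use t in \<open>simp_all add: f_def g_def shifted_\<Omega>d_def dt_theta_b\<close>)
qed

text \<open>The relative rotation is conjugate to \<open>Z_rot \<theta>\<close>, whose trace is 1 +
  2 cos \<theta>. The squared distance is therefore 8 sin^2(\<theta>/2), at most 2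
  \<theta>^2.\<close>

lemma norm_shifted_Rd_diff_le:
  assumes t: "0 \<le> t"
  shows "norm (shifted_Rd \<theta>b0 \<gamma> U Rd t - Rd t) \<le> sqrt 2 * \<bar>theta_b \<theta>b0 \<gamma> t\<bar>"
proof -
  define \<theta> where "\<theta> = theta_b \<theta>b0 \<gamma> t"
  have "trace (transpose (Rd t) ** shifted_Rd \<theta>b0 \<gamma> U Rd t)
      = trace (shifted_Rd \<theta>b0 \<gamma> U Rd t ** transpose (Rd t))"
    by (rule trace_mul_sym)
  also have "\<dots> = trace (U ** (Z_rot \<theta> ** transpose U))"
    by (simp add: shifted_Rd_def \<theta>_def rotation_matrixD[OF rot_Rd[OF t]] flip: matrix_mul_assoc)
  also have "\<dots> = trace (Z_rot \<theta>)"
    by (subst trace_mul_sym) (simp add: rotation_matrixD[OF rot_U] flip: matrix_mul_assoc)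
  also have "\<dots> = 1 + 2 * cos (2 * (\<theta> / 2))"
    by (simp add: trace_3)
  finally have "(norm (shifted_Rd \<theta>b0 \<gamma> U Rd t - Rd t))\<^sup>2 = 8 * (sin (\<theta> / 2))\<^sup>2"
    unfolding cos_double_sin
    by (simp add: norm_rotation_diff_sq[OF rotation_matrix_shifted_Rd[OF t] rot_Rd[OF t]])
  also have "\<dots> \<le> 8 * (\<theta> / 2)\<^sup>2"
    using iffD1[OF abs_le_square_iff abs_sin_x_le_abs_x[of "\<theta> / 2"]] by simp
  also have "\<dots> = (sqrt 2 * \<bar>\<theta>\<bar>)\<^sup>2"
    by (simp add: power_mult_distrib power_divide)
  finally show ?thesis
    unfolding \<theta>_def by (rule power2_le_imp_le) simp
qed

lemma norm_shifted_\<Omega>d_diff: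
  assumes t: "0 \<le> t"
  shows "norm (shifted_\<Omega>d \<theta>b0 \<gamma> U Rd \<Omega>d t - \<Omega>d t) = \<bar>\<gamma>\<bar> / 2 * \<bar>theta_b \<theta>b0 \<gamma> t\<bar>"
  by (simp add: shifted_\<Omega>d_def dt_theta_b[OF t] norm_rotation_mult_vec rotation_matrix_transpose
      rotation_matrix_shifted_Rd[OF t] rot_U abs_mult
      del: transpose_matrix_vector)

end

subsection \<open>Exponential stability\<close>

lemma smooth_signal_differentiable:
  assumes "smooth_signal f" "0 \<le> t"
  shows "f differentiable (at t within {0..})"
proof -
  obtain D where D: "\<And>t. 0 \<le> t \<Longrightarrow> D 0 t = f t"
    "\<And>n t. 0 \<le> t \<Longrightarrow> (D n has_vector_derivative D (Suc n) t) (at t within {0..})"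
    using assms(1) unfolding smooth_signal_def by blast
  have "(f has_vector_derivative D (Suc 0) t) (at t within {0..})"
    by (rule has_vector_derivative_transform[OF _ _ D(2)]) (use assms(2) D(1) in auto)
  then show ?thesis
    by (rule differentiableI_vector)
qed

theorem mainTheorem8:
  fixes J :: "real^3^3"
    and Rd :: "real \<Rightarrow> real^3^3" and \<Omega>d :: "real \<Rightarrow> real^3"
    and \<theta>0 :: "real^3^3 \<Rightarrow> real" and U0 :: "real^3^3 \<Rightarrow> real^3^3"
    and kR k\<Omega> a \<mu> \<sigma> \<epsilon> \<theta>b0 \<gamma> :: real
  assumes "spd_matrix J"
    and "reference_trajectory Rd \<Omega>d"
    and "attitude_error_choice (Rd 0) \<theta>0 U0"
    and "0 < kR" "0 < k\<Omega>" "0 < a" "0 < \<mu>" "0 < \<sigma>" "0 < \<epsilon>" "0 < \<theta>b0" "0 < \<gamma>"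
    and "a < 1" and "\<epsilon> < 1"
    and "\<mu> < 4 * (1 - a) * kR * k\<Omega> / (4 * (1 - a) * kR + k\<Omega>\<^sup>2)"
    and "\<sigma> = lambda_min (W3 kR k\<Omega> a \<mu>) / lambda_max (W2 kR \<mu>)"
    and "\<gamma> < 4 / \<theta>b0 * sqrt (a * kR * (1 - \<epsilon>))"
  shows "zero_exponentially_stable
           {(\<lambda>t. (R t - Rd t, \<Omega> t - \<Omega>d t)) | R \<Omega>.
              closed_loop_motion J kR k\<Omega> a \<theta>b0 \<gamma> U0 Rd \<Omega>d R \<Omega>} \<and>
         (\<exists>c>0. \<forall>R \<Omega>. closed_loop_motion J kR k\<Omega> a \<theta>b0 \<gamma> U0 Rd \<Omega>d R \<Omega> \<longrightarrow>
            V0 kR Rd \<Omega>d (R 0) (\<Omega> 0) 0 \<le> 2 * a * kR \<longrightarrow>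
            (\<forall>t\<ge>0. norm (R t - Rd t) + norm (\<Omega> t - \<Omega>d t)
               \<le> c * (norm (R 0 - Rd 0) + norm (\<Omega> 0 - \<Omega>d 0)) * exp (- (\<sigma> / 2) * t))) \<and>
         (\<exists>c>0. \<forall>R \<Omega>. closed_loop_motion J kR k\<Omega> a \<theta>b0 \<gamma> U0 Rd \<Omega>d R \<Omega> \<longrightarrow>
            V0 kR Rd \<Omega>d (R 0) (\<Omega> 0) 0 > 2 * a * kR \<longrightarrow>
            \<theta>b0 < \<theta>0 (R 0) \<longrightarrow> 1 - cos (\<theta>0 (R 0) - \<theta>b0) \<le> 2 * \<epsilon> * a \<longrightarrow>
            kR / 4 * (norm (R 0 - shifted_Rd \<theta>b0 \<gamma> (U0 (R 0)) Rd 0))\<^sup>2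
              + 1 / 2 * (norm (\<Omega> 0 - shifted_\<Omega>d \<theta>b0 \<gamma> (U0 (R 0)) Rd \<Omega>d 0))\<^sup>2 \<le> 2 * a * kR \<longrightarrow>
            (\<forall>t\<ge>0. norm (R t - Rd t) + norm (\<Omega> t - \<Omega>d t)
               \<le> c * (norm (R 0 - Rd 0) + norm (\<Omega> 0 - \<Omega>d 0))
                   * exp (- (1 / 2) * min \<sigma> \<gamma> * t)))"
proof -
  have Rd: "\<And>t. 0 \<le> t \<Longrightarrow> rotation_matrix (Rd t)"
    "\<And>t. 0 \<le> t \<Longrightarrow> (Rd has_vector_derivative Rd t ** hat (\<Omega>d t)) (at t within {0..})"
    and \<Omega>d: "\<And>t. 0 \<le> t \<Longrightarrow> \<Omega>d differentiable (at t within {0..})"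
    using assms(2) smooth_signal_differentiable unfolding reference_trajectory_def by blast+
  note decay = tracking_error_decay[OF _ \<open>0 < kR\<close> \<open>0 < k\<Omega>\<close> \<open>0 < a\<close> \<open>a < 1\<close> \<open>0 < \<mu>\<close> \<open>0 < \<sigma>\<close> assms(14,15)]
  \<comment> \<open>p bounds the energy by the squared error. G joins the reverse comparison with
    the prefactor of the energy decay and is positive because \<mu> < sqrt kR.\<close>
  define p where "p = kR / 4 + 1 / 2"
  define G where "G = 2 / min (kR / 4) (1 / 2) * ((sqrt kR + \<mu>) / (sqrt kR - \<mu>))"
  define E where "E R \<Omega> t = norm (R t - Rd t) + norm (\<Omega> t - \<Omega>d t)"
    for R :: "real \<Rightarrow> real^3^3" and \<Omega> :: "real \<Rightarrow> real^3" and t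
  let ?cl = "closed_loop_motion J kR k\<Omega> a \<theta>b0 \<gamma> U0 Rd \<Omega>d"
  have p: "0 < p" and G: "0 < G"
    using assms coupling_less_sqrt[OF \<open>0 < kR\<close> \<open>0 < k\<Omega>\<close> \<open>0 < a\<close> \<open>a < 1\<close> assms(14)]
    by (auto simp: p_def G_def intro!: divide_pos_pos mult_pos_pos add_pos_pos)
  have V0_le: "V0 kR Rd \<Omega>d (R 0) (\<Omega> 0) 0 \<le> p * (E R \<Omega> 0)\<^sup>2" for R \<Omega>
    unfolding E_def p_def by (rule energy_le_error_sq[OF \<open>0 < kR\<close>])
  have E_nonneg: "0 \<le> E R \<Omega> t" for R \<Omega> t
    by (simp add: E_def)

  \<comment> \<open>Case (a): small initial energy\<close>
  define ca where "ca = sqrt (G * p)"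
  have ca: "0 < ca"
    using p G by (simp add: ca_def)
  have partA: "E R \<Omega> t \<le> ca * E R \<Omega> 0 * exp (- (\<sigma> / 2) * t)"
    if cl: "?cl R \<Omega>" and V: "V0 kR Rd \<Omega>d (R 0) (\<Omega> 0) 0 \<le> 2 * a * kR" and t: "0 \<le> t" for R \<Omega> t
  proof -
    have "tracking_motion kR k\<Omega> Rd \<Omega>d R \<Omega>"
      by (rule tracking_motionI[OF assms(1) cl[unfolded closed_loop_motion_def] _ Rd \<Omega>d])
        (use V in \<open>simp_all add: control_input_def\<close>)
    from decay[OF this V t]
    have "E R \<Omega> t \<le> sqrt (G * V0 kR Rd \<Omega>d (R 0) (\<Omega> 0) 0) * exp (- (\<sigma> / 2) * t)"
      by (simp only: E_def G_def)
    also have "sqrt (G * V0 kR Rd \<Omega>d (R 0) (\<Omega> 0) 0) \<le> sqrt (G * (p * (E R \<Omega> 0)\<^sup>2))"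
      using V0_le G by (intro real_sqrt_le_mono mult_left_mono) auto
    also have "\<dots> = ca * E R \<Omega> 0"
      using E_nonneg by (simp add: ca_def real_sqrt_mult)
    finally show ?thesis
      by simp
  qed

  \<comment> \<open>Case (b): large initial energy\<close>
  define cb where "cb = sqrt (G * (2 * a * kR)) + (sqrt 2 + \<gamma> / 2) * \<theta>b0"
  \<comment> \<open>Outside the sublevel set \<open>p * (E R \<Omega> 0)\<^sup>2\<close> exceeds
    \<open>2 * a * kR\<close>, so \<delta> is a lower bound for the initial error.\<close>
  define \<delta> where "\<delta> = sqrt (2 * a * kR / p)"
  have cb: "0 < cb" and \<delta>: "0 < \<delta>"
    using assms p G by (simp_all add: cb_def \<delta>_def add_pos_pos)
  have partB: "E R \<Omega> t \<le> cb / \<delta> * E R \<Omega> 0 * exp (- (1 / 2) * min \<sigma> \<gamma> * t)"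
    if cl: "?cl R \<Omega>" and V: "2 * a * kR < V0 kR Rd \<Omega>d (R 0) (\<Omega> 0) 0"
      and init: "kR / 4 * (norm (R 0 - shifted_Rd \<theta>b0 \<gamma> (U0 (R 0)) Rd 0))\<^sup>2
        + 1 / 2 * (norm (\<Omega> 0 - shifted_\<Omega>d \<theta>b0 \<gamma> (U0 (R 0)) Rd \<Omega>d 0))\<^sup>2 \<le> 2 * a * kR"
      and t: "0 \<le> t" for R \<Omega> t
  proof -
    define S where "S = shifted_Rd \<theta>b0 \<gamma> (U0 (R 0)) Rd"
    define \<Omega>S where "\<Omega>S = shifted_\<Omega>d \<theta>b0 \<gamma> (U0 (R 0)) Rd \<Omega>d"
    \<comment> \<open>A common majorant of the tracking decay exp (- \<sigma> t / 2) and of the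
      decay exp (- \<gamma> t / 2) of the shift angle.\<close>
    define m where "m = exp (- (1 / 2) * min \<sigma> \<gamma> * t)"
    have body: "rigid_body_motion J (control_input J kR k\<Omega> a \<theta>b0 \<gamma> U0 Rd \<Omega>d R \<Omega>) R \<Omega>"
      using cl by (simp add: closed_loop_motion_def)
    then have U: "rotation_matrix (U0 (R 0))"
      using assms(3) by (simp add: rigid_body_motion_def attitude_error_choice_def)
    note shifted = rotation_matrix_shifted_Rd[OF Rd(1) U Rd(2) \<Omega>d]
      shifted_Rd_has_vector_derivative[OF Rd(1) U Rd(2) \<Omega>d]
      shifted_\<Omega>d_differentiable[OF Rd(1) U Rd(2) \<Omega>d]
    have S_near: "norm (S t - Rd t) \<le> sqrt 2 * \<bar>theta_b \<theta>b0 \<gamma> t\<bar>"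
      unfolding S_def by (rule norm_shifted_Rd_diff_le[where \<Omega>d=\<Omega>d]) (use Rd U \<Omega>d t in auto)
    have \<Omega>S_near: "norm (\<Omega>S t - \<Omega>d t) = \<bar>\<gamma>\<bar> / 2 * \<bar>theta_b \<theta>b0 \<gamma> t\<bar>"
      unfolding \<Omega>S_def by (rule norm_shifted_\<Omega>d_diff) (use Rd U \<Omega>d t in auto)
    have motion: "tracking_motion kR k\<Omega> S \<Omega>S R \<Omega>"
      unfolding S_def \<Omega>S_def
      by (rule tracking_motionI[OF assms(1) body _ shifted(1-3)])
        (use V in \<open>simp_all add: control_input_def\<close>)
    have V0S: "V0 kR S \<Omega>S (R 0) (\<Omega> 0) 0 \<le> 2 * a * kR"
      using init by (simp add: V0_def S_def \<Omega>S_def)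
    have "norm (R t - S t) + norm (\<Omega> t - \<Omega>S t)
        \<le> sqrt (G * V0 kR S \<Omega>S (R 0) (\<Omega> 0) 0) * exp (- (\<sigma> / 2) * t)"
      unfolding G_def by (rule decay[OF motion V0S t])
    also have "\<dots> \<le> sqrt (G * (2 * a * kR)) * m"
    proof (intro mult_mono real_sqrt_le_mono mult_left_mono)
      show "exp (- (\<sigma> / 2) * t) \<le> m"
        using t by (simp add: m_def mult_right_mono)
    qed (use V0S G assms V0_nonneg in auto)
    finally have near: "norm (R t - S t) + norm (\<Omega> t - \<Omega>S t) \<le> sqrt (G * (2 * a * kR)) * m" .
    have "\<bar>theta_b \<theta>b0 \<gamma> t\<bar> \<le> \<theta>b0 * m"
      using t \<open>0 < \<theta>b0\<close> by (simp add: theta_b_def m_def mult_right_mono abs_mult)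
    then have "(sqrt 2 + \<gamma> / 2) * \<bar>theta_b \<theta>b0 \<gamma> t\<bar> \<le> (sqrt 2 + \<gamma> / 2) * (\<theta>b0 * m)"
      using \<open>0 < \<gamma>\<close> by (intro mult_left_mono) auto
    moreover have "norm (S t - Rd t) + norm (\<Omega>S t - \<Omega>d t) \<le> (sqrt 2 + \<gamma> / 2) * \<bar>theta_b \<theta>b0 \<gamma> t\<bar>"
      using S_near \<Omega>S_near \<open>0 < \<gamma>\<close> by (simp add: distrib_right)
    moreover have "norm (R t - Rd t) \<le> norm (R t - S t) + norm (S t - Rd t)"
      "norm (\<Omega> t - \<Omega>d t) \<le> norm (\<Omega> t - \<Omega>S t) + norm (\<Omega>S t - \<Omega>d t)"
      using norm_triangle_ineq[of "R t - S t" "S t - Rd t"]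
        norm_triangle_ineq[of "\<Omega> t - \<Omega>S t" "\<Omega>S t - \<Omega>d t"] by simp_all
    \<comment> \<open>The first summand of \<open>cb\<close> bounds the error to the shifted
      reference, the second the distance between the two references.\<close>
    ultimately have "E R \<Omega> t \<le> cb * m"
      using near unfolding E_def cb_def distrib_right mult.assoc by linarith
    also have "cb * m \<le> cb / \<delta> * E R \<Omega> 0 * m"
    proof -
      have "2 * a * kR / p \<le> (E R \<Omega> 0)\<^sup>2"
        using V V0_le[of R \<Omega>] p by (simp add: pos_divide_le_eq mult.commute)
      then have "\<delta> \<le> E R \<Omega> 0"
        unfolding \<delta>_def using E_nonneg by (simp add: real_le_lsqrt)
      then have "cb \<le> cb / \<delta> * E R \<Omega> 0"
        using cb \<delta> by (simp add: field_simps)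
      then show ?thesis
        by (rule mult_right_mono) (simp add: m_def)
    qed
    finally show ?thesis
      unfolding m_def .
  qed

  \<comment> \<open>The equilibrium and its local stability\<close>
  have equilibrium: "?cl Rd \<Omega>d"
  proof -
    \<comment> \<open>Zero energy selects the first law, whose feedback terms vanish on the
      reference.\<close>
    have "V0 kR Rd \<Omega>d (Rd 0) (\<Omega>d 0) 0 \<le> 2 * a * kR"
      using assms by (simp add: V0_def)
    moreover have "e_R A A = 0" for A
      by (simp add: e_R_eq_axial vec_eq_iff forall_3 mat3_simps)
    ultimately show ?thesis
      using Rd \<Omega>d
      by (simp add: closed_loop_motion_def rigid_body_motion_def control_input_def tracking_torque_def)
  qed
  \<comment> \<open>The sum of the two norms is at most twice the norm of the pair. Halving \<delta>
    thus forces the initial energy below \<open>2 * a * kR\<close>, and nearby motions all fall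
    under case (a).\<close>
  define r where "r = sqrt (2 * a * kR / p) / 2"
  have r: "0 < r"
    using assms p by (simp add: r_def)
  have local_decay: "norm (R t - Rd t, \<Omega> t - \<Omega>d t)
      \<le> 2 * ca * norm (R 0 - Rd 0, \<Omega> 0 - \<Omega>d 0) * exp (- (\<sigma> / 2) * t)"
    if cl: "?cl R \<Omega>" and small: "norm (R 0 - Rd 0, \<Omega> 0 - \<Omega>d 0) < r" and t: "0 \<le> t" for R \<Omega> t
  proof -
    let ?e = "\<lambda>t. (R t - Rd t, \<Omega> t - \<Omega>d t)"
    have E0: "E R \<Omega> 0 \<le> 2 * norm (?e 0)"
      using norm_fst_le[of "R 0 - Rd 0" "\<Omega> 0 - \<Omega>d 0"] norm_snd_le[of "\<Omega> 0 - \<Omega>d 0" "R 0 - Rd 0"]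
      by (simp add: E_def)
    then have "(E R \<Omega> 0)\<^sup>2 \<le> (sqrt (2 * a * kR / p))\<^sup>2"
      using small E_nonneg by (intro power_mono) (auto simp: r_def)
    then have "p * (E R \<Omega> 0)\<^sup>2 \<le> 2 * a * kR"
      using p assms by (simp add: field_simps)
    then have "V0 kR Rd \<Omega>d (R 0) (\<Omega> 0) 0 \<le> 2 * a * kR"
      using V0_le[of R \<Omega>] by linarith
    then have "E R \<Omega> t \<le> ca * E R \<Omega> 0 * exp (- (\<sigma> / 2) * t)"
      by (rule partA[OF cl _ t])
    also have "\<dots> \<le> ca * (2 * norm (?e 0)) * exp (- (\<sigma> / 2) * t)"
      using E0 ca by (intro mult_right_mono mult_left_mono) auto
    finally show ?thesis
      using norm_Pair_le[of "R t - Rd t" "\<Omega> t - \<Omega>d t"] by (simp add: E_def mult_ac)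
  qed

  show ?thesis
    unfolding zero_exponentially_stable_def
  proof (intro conjI)
    show "\<exists>e\<in>{(\<lambda>t. (R t - Rd t, \<Omega> t - \<Omega>d t)) | R \<Omega>. ?cl R \<Omega>}. \<forall>t\<ge>0. e t = 0"
    proof (rule bexI)
      show "(\<lambda>t. (Rd t - Rd t, \<Omega>d t - \<Omega>d t)) \<in> {(\<lambda>t. (R t - Rd t, \<Omega> t - \<Omega>d t)) | R \<Omega>. ?cl R \<Omega>}"
        using equilibrium by blast
    qed (simp add: zero_prod_def)
    show "\<exists>r>0. \<exists>c>0. \<exists>\<beta>>0. \<forall>e\<in>{(\<lambda>t. (R t - Rd t, \<Omega> t - \<Omega>d t)) | R \<Omega>. ?cl R \<Omega>}.
        norm (e 0) < r \<longrightarrow> (\<forall>t\<ge>0. norm (e t) \<le> c * norm (e 0) * exp (- \<beta> * t))"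
      using r ca \<open>0 < \<sigma>\<close> local_decay
      by (intro exI[of _ r] exI[of _ "2 * ca"] exI[of _ "\<sigma> / 2"] conjI) auto
  qed (use partA ca in \<open>unfold E_def, blast\<close>, use partB cb \<delta> in \<open>unfold E_def, blast intro: divide_pos_pos\<close>)
qed

end
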